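(* Let $\lambda$ be a partition and let $\theta=(\theta_i)_{i\geq 1}$ be a bounded sequence of positive real numbers such that $\sup\theta<1$. Then the sequence $\left(S_\lambda^{\mathfrak{gl}_r}(\theta_{[r]})\right)_r$ (defined for integers $r\geq 1$ with $r\geq\ell(\lambda)$) is convergent as $r\to\infty$. (Its limit is denoted $S_\lambda^A(\theta)$.)
   Context: A partition is a weakly decreasing sequence of nonnegative integers with finitely many nonzero terms; $\ell(\lambda)$ is the number of nonzero terms of $\lambda$. Let $(\varepsilon_1,\ldots,\varepsilon_r)$ be the standard orthonormal basis of a Euclidean space with inner product $\langle\cdot,\cdot\rangle$. A partition $\lambda$ with $\ell(\lambda)\leq r$ is identified with the dominant weight $\sum_{i=1}^r\lambda_i\varepsilon_i$ of $\mathfrak{gl}_r=\mathfrak{gl}_r(\mathbb{C})$, and $V^{\mathfrak{gl}_r}(\lambda)$ denotes the irreducible polynomial representation with highest weight $\lambda$. Let $P^{\mathfrak{gl}_r}(\lambda)$ be its set of weights and $K_{\lambda\,\omega}^{\mathfrak{gl}_r}$ the dimension of its $\omega$-weight space. The simple roots are $\alpha_i=\varepsilon_i-\varepsilon_{i+1}$ for $1\leq i\leq r-1$, and $\omega_i^\vee=\sum_{j=1}^i\varepsilon_j$ for $1\leq i\leq r-1$. For every weight $\omega\in P^{\mathfrak{gl}_r}(\lambda)$ one has $\lambda-\omega=\sum_{i=1}^{r-1}\langle\lambda-\omega,\omega_i^\vee\rangle\alpha_i$ with nonnegative integer coefficients. For $\theta_{[r]}=(\theta_1,\ldots,\theta_{r-1})$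 one sets \[S_\lambda^{\mathfrak{gl}_r}(\theta_{[r]})=\sum_{\omega\in P^{\mathfrak{gl}_r}(\lambda)}K_{\lambda\,\omega}^{\mathfrak{gl}_r}\prod_{i=1}^{r-1}\theta_i^{\langle\lambda-\omega,\omega_i^\vee\rangle}.\] *)

theory Defs
  imports "Jordan_Normal_Form.VS_Connect"
begin

(* All sequences are indexed from 0: position i carries the entry with index i + 1 of the usual
   1-based notation. Weights of gl_r are integer sequences that vanish from position r on. *)

definition is_partition :: "(nat \<Rightarrow> nat) \<Rightarrow> bool" where
  "is_partition lam \<longleftrightarrow> antimono lam \<and> finite {i. lam i \<noteq> 0}"

definition partition_length :: "(nat \<Rightarrow> nat) \<Rightarrow> nat" where
  "partition_length lam = card {i. lam i \<noteq> 0}"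

(* A representation of gl_r(C) on C^d, as a Lie algebra homomorphism into gl_d(C). *)
definition gl_rep :: "nat \<Rightarrow> nat \<Rightarrow> (complex mat \<Rightarrow> complex mat) \<Rightarrow> bool" where
  "gl_rep r d \<rho> \<longleftrightarrow>
     (\<forall>X\<in>carrier_mat r r. \<rho> X \<in> carrier_mat d d) \<and>
     (\<forall>X\<in>carrier_mat r r. \<forall>Y\<in>carrier_mat r r. \<rho> (X + Y) = \<rho> X + \<rho> Y) \<and>
     (\<forall>c. \<forall>X\<in>carrier_mat r r. \<rho> (c \<cdot>\<^sub>m X) = c \<cdot>\<^sub>m \<rho> X) \<and>
     (\<forall>X\<in>carrier_mat r r. \<forall>Y\<in>carrier_mat r r.
        \<rho> (X * Y - Y * X) = \<rho> X * \<rho> Y - \<rho> Y * \<rho> X)"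

definition irreducible_gl_rep :: "nat \<Rightarrow> nat \<Rightarrow> (complex mat \<Rightarrow> complex mat) \<Rightarrow> bool" where
  "irreducible_gl_rep r d \<rho> \<longleftrightarrow> gl_rep r d \<rho> \<and> d > 0 \<and>
     (\<forall>W. subspace class_ring W (module_vec TYPE(complex) d) \<and>
          (\<forall>X\<in>carrier_mat r r. \<forall>w\<in>W. \<rho> X *\<^sub>v w \<in> W)
        \<longrightarrow> W = {0\<^sub>v d} \<or> W = carrier_vec d)"

(* The Cartan subalgebra consists of the diagonal matrices; the weight \<omega> takes the value
   \<Sum>i<r. h i * \<omega> i on the diagonal matrix with entries h i. *)
definition weight_space ::
    "nat \<Rightarrow> nat \<Rightarrow> (complex mat \<Rightarrow> complex mat) \<Rightarrow> (nat \<Rightarrow> int) \<Rightarrow> complex vec set" where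
  "weight_space r d \<rho> \<omega> = {v \<in> carrier_vec d.
     \<forall>h. \<rho> (mat_diag r h) *\<^sub>v v = (\<Sum>i<r. h i * of_int (\<omega> i)) \<cdot>\<^sub>v v}"

definition has_highest_weight ::
    "nat \<Rightarrow> nat \<Rightarrow> (complex mat \<Rightarrow> complex mat) \<Rightarrow> (nat \<Rightarrow> int) \<Rightarrow> bool" where
  "has_highest_weight r d \<rho> \<omega> \<longleftrightarrow>
     (\<exists>v\<in>weight_space r d \<rho> \<omega>. v \<noteq> 0\<^sub>v d \<and>
        (\<forall>X\<in>carrier_mat r r. (\<forall>i<r. \<forall>j\<le>i. X $$ (i, j) = 0) \<longrightarrow> \<rho> X *\<^sub>v v = 0\<^sub>v d))"

(* V(lam), as a pair of its dimension and its action. It is unique up to isomorphism, so the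
   weights and multiplicities below do not depend on the choice. *)
definition gl_irrep :: "nat \<Rightarrow> (nat \<Rightarrow> nat) \<Rightarrow> nat \<times> (complex mat \<Rightarrow> complex mat)" where
  "gl_irrep r lam = (SOME (d, \<rho>).
     irreducible_gl_rep r d \<rho> \<and> has_highest_weight r d \<rho> (\<lambda>i. int (lam i)))"

definition gl_weight_space :: "nat \<Rightarrow> (nat \<Rightarrow> nat) \<Rightarrow> (nat \<Rightarrow> int) \<Rightarrow> complex vec set" where
  "gl_weight_space r lam \<omega> = weight_space r (fst (gl_irrep r lam)) (snd (gl_irrep r lam)) \<omega>"

definition gl_weights :: "nat \<Rightarrow> (nat \<Rightarrow> nat) \<Rightarrow> (nat \<Rightarrow> int) set" where
  "gl_weights r lam = {\<omega>. (\<forall>i\<ge>r. \<omega> i = 0) \<and>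
     gl_weight_space r lam \<omega> \<noteq> {0\<^sub>v (fst (gl_irrep r lam))}}"

definition gl_mult :: "nat \<Rightarrow> (nat \<Rightarrow> nat) \<Rightarrow> (nat \<Rightarrow> int) \<Rightarrow> nat" where
  "gl_mult r lam \<omega> = vectorspace.dim class_ring
     ((module_vec TYPE(complex) (fst (gl_irrep r lam)))\<lparr>carrier := gl_weight_space r lam \<omega>\<rparr>)"

definition weight_inner :: "nat \<Rightarrow> (nat \<Rightarrow> int) \<Rightarrow> (nat \<Rightarrow> int) \<Rightarrow> int" where
  "weight_inner r x y = (\<Sum>j<r. x j * y j)"

definition fund_coweight :: "nat \<Rightarrow> nat \<Rightarrow> int" where
  "fund_coweight i = (\<lambda>j. if j \<le> i then 1 else 0)"

definition S_gl :: "nat \<Rightarrow> (nat \<Rightarrow> nat) \<Rightarrow> (nat \<Rightarrow> real) \<Rightarrow> real" where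
  "S_gl r lam \<theta> = (\<Sum>\<omega>\<in>gl_weights r lam. real (gl_mult r lam \<omega>) *
     (\<Prod>i<r - 1. \<theta> i powi weight_inner r (\<lambda>j. int (lam j) - \<omega> j) (fund_coweight i)))"

end

theory Submission
  imports Defs "HOL-Library.Function_Algebras" "HOL-Combinatorics.Permutations"
begin

text \<open>
  The sequence is increasing and bounded.

  Everything rests on a comparison of multiplicities (\<open>multiplicity_le_descent\<close>): if \<open>V\<close> is an
  irreducible module of \<open>gl_r\<close> with highest weight vector \<open>v\<close> of weight \<open>lam\<close>, and \<open>v'\<close> is a highest
  weight vector of the same weight in any module \<open>V'\<close>, then a weight \<open>\<omega>\<close> has at most as large a
  multiplicity in \<open>V\<close> as in the submodule of \<open>V'\<close> generated by \<open>v'\<close>. Indeed, the submodule \<open>M\<close> of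
  \<open>V \<oplus> V'\<close> generated by \<open>(v, v')\<close> projects onto \<open>V\<close>, and the kernel of its projection to \<open>V'\<close> is a
  submodule of \<open>V\<close>. The kernel is not all of \<open>V\<close>, because the vectors of weight \<open>lam\<close> in \<open>M\<close> are the
  multiples of \<open>(v, v')\<close>; so it vanishes, and \<open>M\<close> embeds into \<open>V'\<close>. Applied both ways, this also shows that
  the multiplicities of \<open>V\<close> are determined by \<open>lam\<close>.

  With the irreducible module of \<open>gl_(r+1)\<close>, restricted to \<open>gl_r\<close>, in the role of \<open>V'\<close>, multiplicities
  do not decrease with \<open>r\<close> (\<open>irrep.mult_le_Suc\<close>). The monomial of a weight of \<open>gl_r\<close> does not
  change either, since its new exponent \<open>|lam| - |\<omega>|\<close> is \<open>0\<close>. All terms being nonnegative, the sums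
  increase (\<open>irrep.S_gl_le_Suc\<close>).

  With the tensor power of degree \<open>n = |lam|\<close> of the natural module in the role of \<open>V'\<close>, the
  multiplicity of \<open>\<omega>\<close> is at most the number of words of length \<open>n\<close> in which each letter \<open>c\<close> occurs
  \<open>\<omega> c\<close> times. Let \<open>l\<close> be the length of \<open>lam\<close> and \<open>q < 1\<close> the supremum of \<open>\<theta>\<close>. For \<open>i \<ge> l\<close> the
  exponent of \<open>\<theta> i\<close> counts the letters above \<open>i\<close>, and for \<open>i < l\<close> it is nonnegative; so the monomial
  of a word is at most the product of \<open>q ^ (a - l)\<close> over its letters \<open>a\<close>. Summing over all words
  gives the bound \<open>(l + 1 / (1 - q)) ^ n\<close>, which does not involve \<open>r\<close> (\<open>irrep.S_gl_le\<close>).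

  The irreducible module in the statement is a chosen one, so its existence has to be shown
  (\<open>gl_irrep_correct\<close>). The tensor power contains a highest weight vector of weight \<open>lam\<close>, a
  product of antisymmetric tensors along the columns of \<open>lam\<close>; the submodule that it
  generates, divided by a maximal proper submodule, is irreducible.
\<close>

section \<open>Modules generated by a highest weight vector\<close>

text \<open>Vectors are complex functions on an index type: words for tensor powers, numbers for
  coordinate vectors, a sum type for direct sums. So all modules share one vector space structure,
  and the theory of spans and independence applies to them.\<close>

definition cscale :: "complex \<Rightarrow> ('i \<Rightarrow> complex) \<Rightarrow> 'i \<Rightarrow> complex" where
  "cscale c f = (\<lambda>i. c * f i)"

lemma cscale_apply: "cscale c f i = c * f i"
  by (simp add: cscale_def)

text \<open>Induction rules for functions produce eta-expanded goals, in which the pointwise rules would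
  dissolve the vector operations. They are therefore used only on request.\<close>

declare plus_fun_apply [simp del] zero_fun_apply [simp del] minus_apply [simp del]
  uminus_apply [simp del]

lemmas pointwise = cscale_apply plus_fun_apply zero_fun_apply minus_apply uminus_apply

global_interpretation cf: vector_space "cscale :: complex \<Rightarrow> ('i \<Rightarrow> complex) \<Rightarrow> 'i \<Rightarrow> complex"
  by unfold_locales (simp_all add: fun_eq_iff pointwise algebra_simps)

lemma sum_apply: "(\<Sum>i\<in>I. F i) j = (\<Sum>i\<in>I. F i j :: complex)"
  by (induction I rule: infinite_finite_induct) (simp_all add: pointwise)

definition indicator_at :: "'i \<Rightarrow> 'i \<Rightarrow> complex" where
  "indicator_at i = (\<lambda>j. if j = i then 1 else 0)"

lemma finitely_supported_in_span:
  assumes "finite W" "\<And>w. x w \<noteq> 0 \<Longrightarrow> w \<in> W"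
  shows "x \<in> cf.span (indicator_at ` W)"
proof -
  have "x = (\<Sum>w\<in>W. cscale (x w) (indicator_at w))"
  proof
    fix u
    show "x u = (\<Sum>w\<in>W. cscale (x w) (indicator_at w)) u"
      unfolding sum_apply using assms by (auto simp: pointwise indicator_at_def if_distrib cong: if_cong)
  qed
  also have "\<dots> \<in> cf.span (indicator_at ` W)"
    by (intro cf.span_sum cf.span_scale cf.span_base) auto
  finally show ?thesis .
qed

text \<open>The action of \<open>gl_r\<close> is given by the operators of the matrix units. The operators for indices
  below \<open>r\<close> alone are constrained, so that an action of a larger algebra restricts to \<open>gl_r\<close>
  without any change of \<open>E\<close>.\<close>

locale gl_action =
  fixes r :: nat and E :: "nat \<Rightarrow> nat \<Rightarrow> ('i \<Rightarrow> complex) \<Rightarrow> 'i \<Rightarrow> complex"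
  assumes add: "\<lbrakk>a < r; b < r\<rbrakk> \<Longrightarrow> E a b (x + y) = E a b x + E a b y"
    and scale: "\<lbrakk>a < r; b < r\<rbrakk> \<Longrightarrow> E a b (cscale k x) = cscale k (E a b x)"
    and bracket: "\<lbrakk>a < r; b < r; c < r; d < r\<rbrakk> \<Longrightarrow> E a b (E c d x) =
      E c d (E a b x) + (if b = c then E a d x else 0) - (if a = d then E c b x else 0)"
begin

lemma zero: "\<lbrakk>a < r; b < r\<rbrakk> \<Longrightarrow> E a b 0 = 0"
  using add[of a b 0 0] by simp

lemma sum: "\<lbrakk>a < r; b < r\<rbrakk> \<Longrightarrow> E a b (\<Sum>i\<in>I. f i) = (\<Sum>i\<in>I. E a b (f i))"
  by (induction I rule: infinite_finite_induct) (simp_all add: zero add)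

end

definition weight_vector ::
    "nat \<Rightarrow> (nat \<Rightarrow> nat \<Rightarrow> ('i \<Rightarrow> complex) \<Rightarrow> 'i \<Rightarrow> complex) \<Rightarrow> (nat \<Rightarrow> int) \<Rightarrow> ('i \<Rightarrow> complex) \<Rightarrow> bool"
  where "weight_vector r E \<omega> x \<longleftrightarrow> (\<forall>a<r. E a a x = cscale (of_int (\<omega> a)) x)"

definition hw_vector ::
    "nat \<Rightarrow> (nat \<Rightarrow> nat \<Rightarrow> ('i \<Rightarrow> complex) \<Rightarrow> 'i \<Rightarrow> complex) \<Rightarrow> (nat \<Rightarrow> int) \<Rightarrow> ('i \<Rightarrow> complex) \<Rightarrow> bool"
  where "hw_vector r E lam v \<longleftrightarrow> v \<noteq> 0 \<and> weight_vector r E lam v \<and>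
    (\<forall>a b. a < b \<longrightarrow> b < r \<longrightarrow> E a b v = 0)"

definition invariant ::
    "nat \<Rightarrow> (nat \<Rightarrow> nat \<Rightarrow> ('i \<Rightarrow> complex) \<Rightarrow> 'i \<Rightarrow> complex) \<Rightarrow> ('i \<Rightarrow> complex) set \<Rightarrow> bool"
  where "invariant r E W \<longleftrightarrow> cf.subspace W \<and> (\<forall>a<r. \<forall>b<r. \<forall>x\<in>W. E a b x \<in> W)"

text \<open>Vectors obtained from \<open>v\<close> by strictly lower triangular matrix units. The weight is carried
  along as an index; that it is indeed the weight of the vector follows from the bracket relations.\<close>

inductive descends ::
    "nat \<Rightarrow> (nat \<Rightarrow> nat \<Rightarrow> ('i \<Rightarrow> complex) \<Rightarrow> 'i \<Rightarrow> complex) \<Rightarrow> (nat \<Rightarrow> int) \<Rightarrow> ('i \<Rightarrow> complex) \<Rightarrow>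
      (nat \<Rightarrow> int) \<Rightarrow> ('i \<Rightarrow> complex) \<Rightarrow> bool"
  for r E lam v where
  top: "descends r E lam v lam v"
| lower: "\<lbrakk>descends r E lam v \<omega> x; b < a; a < r\<rbrakk> \<Longrightarrow>
    descends r E lam v (\<omega>(a := \<omega> a + 1, b := \<omega> b - 1)) (E a b x)"

definition descent_space ::
    "nat \<Rightarrow> (nat \<Rightarrow> nat \<Rightarrow> ('i \<Rightarrow> complex) \<Rightarrow> 'i \<Rightarrow> complex) \<Rightarrow> (nat \<Rightarrow> int) \<Rightarrow> ('i \<Rightarrow> complex) \<Rightarrow>
      (nat \<Rightarrow> int) \<Rightarrow> ('i \<Rightarrow> complex) set"
  where "descent_space r E lam v \<omega> = cf.span {x. descends r E lam v \<omega> x}"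

definition cyclic ::
    "nat \<Rightarrow> (nat \<Rightarrow> nat \<Rightarrow> ('i \<Rightarrow> complex) \<Rightarrow> 'i \<Rightarrow> complex) \<Rightarrow> (nat \<Rightarrow> int) \<Rightarrow> ('i \<Rightarrow> complex) \<Rightarrow>
      ('i \<Rightarrow> complex) set"
  where "cyclic r E lam v = cf.span {x. \<exists>\<omega>. descends r E lam v \<omega> x}"

lemma descends_outside: "descends r E lam v \<omega> x \<Longrightarrow> r \<le> i \<Longrightarrow> \<omega> i = lam i"
  by (induction rule: descends.induct) auto

text \<open>The effect of one lowering step on a linear functional of the weight.\<close>

lemma sum_shift:
  fixes \<omega> :: "nat \<Rightarrow> int"
  assumes "finite S" "a \<noteq> b"
  shows "(\<Sum>j\<in>S. g j * (\<omega>(a := \<omega> a + 1, b := \<omega> b - 1)) j) =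
    (\<Sum>j\<in>S. g j * \<omega> j) + (if a \<in> S then g a else 0) - (if b \<in> S then g b else 0)"
proof -
  have "(\<Sum>j\<in>S. g j * (\<omega>(a := \<omega> a + 1, b := \<omega> b - 1)) j) =
    (\<Sum>j\<in>S. g j * \<omega> j + (if a = j then g a else 0) - (if b = j then g b else 0))"
    using assms(2) by (intro sum.cong) (auto simp: algebra_simps)
  also have "\<dots> = (\<Sum>j\<in>S. g j * \<omega> j) + (if a \<in> S then g a else 0) - (if b \<in> S then g b else 0)"
    using assms(1) by (simp add: sum.distrib sum_subtractf)
  finally show ?thesis .
qed

lemma descends_dominated: "descends r E lam v \<omega> x \<Longrightarrow> (\<Sum>j\<le>i. \<omega> j) \<le> (\<Sum>j\<le>i. lam j)"
proof (induction rule: descends.induct)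
  case (lower \<omega> x b a)
  then show ?case using sum_shift[of "{..i}" a b "\<lambda>_. 1" \<omega>] by auto
qed simp

lemma descends_total: "descends r E lam v \<omega> x \<Longrightarrow> (\<Sum>j<r. \<omega> j) = (\<Sum>j<r. lam j)"
proof (induction rule: descends.induct)
  case (lower \<omega> x b a)
  then show ?case using sum_shift[of "{..<r}" a b "\<lambda>_. 1" \<omega>] by auto
qed simp

text \<open>The moment \<open>\<Sum>j<r. j * \<omega> j\<close> grows with every lowering step, so \<open>v\<close> alone has weight \<open>lam\<close>.\<close>

lemma descends_depth:
  "descends r E lam v \<omega> x \<Longrightarrow> x = v \<and> \<omega> = lam \<or> (\<Sum>j<r. int j * \<omega> j) > (\<Sum>j<r. int j * lam j)"
proof (induction rule: descends.induct)
  case (lower \<omega> x b a)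
  then show ?case using sum_shift[of "{..<r}" a b int \<omega>] by auto
qed simp

lemma descent_space_top: "descent_space r E lam v lam = cf.span {v}"
proof -
  have "{x. descends r E lam v lam x} = {v}"
    using descends_depth[of r E lam v lam] by (auto intro: descends.top)
  then show ?thesis by (simp add: descent_space_def)
qed

context gl_action
begin

lemma subspace_weight: "cf.subspace {x. weight_vector r E \<omega> x}"
  by (rule cf.subspaceI)
    (auto simp: weight_vector_def zero add scale cf.scale_right_distrib mult.commute)

lemma descends_weight:
  assumes "weight_vector r E lam v"
  shows "descends r E lam v \<omega> x \<Longrightarrow> weight_vector r E \<omega> x"
proof (induction rule: descends.induct)
  case top
  then show ?case using assms .
next
  case (lower \<omega> x b a)
  show ?case unfolding weight_vector_def
  proof (intro allI impI)
    fix c assume c: "c < r"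
    have "E c c (E a b x) = E a b (E c c x) + (if c = a then E c b x else 0) - (if c = b then E a c x else 0)"
      using bracket[of c c a b x] lower c by simp
    moreover have "E a b (E c c x) = cscale (of_int (\<omega> c)) (E a b x)"
      using lower c scale by (simp add: weight_vector_def)
    ultimately show "E c c (E a b x) = cscale (of_int ((\<omega>(a := \<omega> a + 1, b := \<omega> b - 1)) c)) (E a b x)"
      using lower by (auto simp: fun_eq_iff pointwise algebra_simps)
  qed
qed

lemma descent_space_weight:
  assumes "weight_vector r E lam v" "x \<in> descent_space r E lam v \<omega>"
  shows "weight_vector r E \<omega> x"
proof -
  have "descent_space r E lam v \<omega> \<subseteq> {x. weight_vector r E \<omega> x}"
    unfolding descent_space_def
    by (rule cf.span_minimal) (auto simp: subspace_weight descends_weight[OF assms(1)])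
  then show ?thesis using assms(2) by auto
qed

lemma span_closed:
  assumes ab: "a < r" "b < r" and "\<And>x. x \<in> S \<Longrightarrow> E a b x \<in> cf.span T" and "x \<in> cf.span S"
  shows "E a b x \<in> cf.span T"
  using assms(4)
proof (induction rule: cf.span_induct_alt)
  case base
  then show ?case by (simp add: zero ab cf.span_zero)
next
  case (step c x y)
  then show ?case using assms(3) ab by (simp add: add scale cf.span_add cf.span_scale)
qed

text \<open>Straightening: a raising or diagonal operator is moved to the right past the lowering operators.
  Each exchange leaves commutator terms with one factor less, and at \<open>v\<close> itself the operator acts
  by a scalar.\<close>

lemma cyclic_invariant:
  assumes "hw_vector r E lam v"
  shows "invariant r E (cyclic r E lam v)"
proof -
  have low: "E a b y \<in> cyclic r E lam v" if "y \<in> cyclic r E lam v" "b < a" "a < r" for a b y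
    unfolding cyclic_def
  proof (rule span_closed)
    show "a < r" "b < r" "y \<in> cf.span {x. \<exists>\<omega>. descends r E lam v \<omega> x}"
      using that by (auto simp: cyclic_def)
    show "E a b x \<in> cf.span {x. \<exists>\<omega>. descends r E lam v \<omega> x}"
      if "x \<in> {x. \<exists>\<omega>. descends r E lam v \<omega> x}" for x
      using that descends.lower[OF _ \<open>b < a\<close> \<open>a < r\<close>] by (blast intro: cf.span_base)
  qed
  have "E c d x \<in> cyclic r E lam v" if "descends r E lam v \<omega> x" "c < r" "d < r" for c d x \<omega>
    using that
  proof (induction arbitrary: c d rule: descends.induct)
    case top
    have v: "v \<in> cyclic r E lam v"
      unfolding cyclic_def by (rule cf.span_base) (auto intro: descends.top)
    consider "c < d" | "c = d" | "d < c" by linarith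
    then show ?case
    proof cases
      case 1
      then show ?thesis using assms top by (simp add: hw_vector_def cyclic_def cf.span_zero)
    next
      case 2
      then have "E c d v = cscale (of_int (lam c)) v"
        using assms top by (simp add: hw_vector_def weight_vector_def)
      then show ?thesis using v by (simp add: cyclic_def cf.span_scale)
    next
      case 3
      then show ?thesis using low[OF v] top by simp
    qed
  next
    case (lower \<omega> x b a)
    have ab: "a < r" "b < r" using lower by auto
    have 1: "E a b (E c d x) \<in> cyclic r E lam v" using low lower by blast
    have 2: "E c b x \<in> cyclic r E lam v" "E a d x \<in> cyclic r E lam v" using lower ab by blast+
    have 3: "(if d = a then E c b x else 0) \<in> cyclic r E lam v"
      "(if c = b then E a d x else 0) \<in> cyclic r E lam v"
      using 2 by (auto simp: cyclic_def cf.span_zero)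
    show ?case using 1 3 unfolding bracket[OF lower(5,6) ab] cyclic_def
      by (intro cf.span_add cf.span_diff)
  qed
  then have "E a b x \<in> cyclic r E lam v" if "a < r" "b < r" "x \<in> cyclic r E lam v" for a b x
    using that span_closed[of a b "{x. \<exists>\<omega>. descends r E lam v \<omega> x}"] unfolding cyclic_def by blast
  then show ?thesis by (auto simp: invariant_def cyclic_def)
qed

text \<open>Joint eigenvectors for distinct eigenvalues. The operator \<open>E c c - \<mu> c\<close> removes the component
  of weight \<open>\<mu>\<close> and, for a suitable \<open>c\<close>, keeps a given other one.\<close>

lemma weight_vectors_independent:
  assumes "finite S" "\<And>\<omega> \<mu>. \<lbrakk>\<omega> \<in> S; \<mu> \<in> S; \<forall>c<r. \<omega> c = \<mu> c\<rbrakk> \<Longrightarrow> \<omega> = \<mu>"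
    "\<And>\<omega>. \<omega> \<in> S \<Longrightarrow> weight_vector r E \<omega> (f \<omega>)" "(\<Sum>\<omega>\<in>S. f \<omega>) = 0" "\<omega> \<in> S"
  shows "f \<omega> = 0"
  using assms
proof (induction S arbitrary: f \<omega> rule: finite_induct)
  case (insert \<mu> S)
  have *: "f \<omega> = 0" if \<omega>: "\<omega> \<in> S" for \<omega>
  proof -
    obtain c where c: "c < r" "\<omega> c \<noteq> \<mu> c" using insert.prems(1) insert.hyps \<omega> by (metis insertI1 insertI2)
    let ?g = "\<lambda>\<omega>. cscale (of_int (\<omega> c - \<mu> c)) (f \<omega>)"
    have "E c c (\<Sum>\<omega>\<in>insert \<mu> S. f \<omega>) - cscale (of_int (\<mu> c)) (\<Sum>\<omega>\<in>insert \<mu> S. f \<omega>) = (\<Sum>\<omega>\<in>insert \<mu> S. ?g \<omega>)"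
      using insert.prems(2) c unfolding sum[OF c(1) c(1)] cf.scale_sum_right sum_subtractf[symmetric]
      by (intro sum.cong) (auto simp: weight_vector_def cf.scale_left_diff_distrib)
    then have "(\<Sum>\<omega>\<in>insert \<mu> S. ?g \<omega>) = 0" using insert.prems(3) c by (simp add: zero)
    then have "(\<Sum>\<omega>\<in>S. ?g \<omega>) = 0" using insert.hyps by simp
    moreover have "weight_vector r E \<omega> (?g \<omega>)" if "\<omega> \<in> S" for \<omega>
      using cf.subspace_scale[OF subspace_weight] insert.prems(2) that by blast
    ultimately have "?g \<omega> = 0" using insert.IH[of ?g \<omega>] insert.prems(1) \<omega> by auto
    then show ?thesis using c cf.scale_eq_0_iff[of "of_int (\<omega> c - \<mu> c)" "f \<omega>"] by simp
  qed
  then have "(\<Sum>\<omega>\<in>S. f \<omega>) = 0" by simp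
  then have "f \<mu> = 0" using insert.prems(3) insert.hyps by simp
  then show ?case using * insert.prems by blast
qed simp

end

lemma cyclic_decomposition:
  assumes "x \<in> cyclic r E lam v"
  shows "\<exists>S f. finite S \<and> (\<forall>\<omega>. f \<omega> \<in> descent_space r E lam v \<omega>) \<and> x = (\<Sum>\<omega>\<in>S. f \<omega>) \<and>
    (\<forall>\<omega>\<in>S. \<forall>i\<ge>r. \<omega> i = lam i)"
  using assms unfolding cyclic_def
proof (induction rule: cf.span_induct_alt)
  case base
  show ?case by (rule exI[of _ "{}"], rule exI[of _ "\<lambda>_. 0"]) (auto simp: descent_space_def cf.span_zero)
next
  case (step c x y)
  from step(2) obtain S f where f: "finite S" "\<And>\<omega>. f \<omega> \<in> descent_space r E lam v \<omega>" "y = (\<Sum>\<omega>\<in>S. f \<omega>)"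
    "\<forall>\<omega>\<in>S. \<forall>i\<ge>r. \<omega> i = lam i" by blast
  from step(1) obtain \<mu> where \<mu>: "descends r E lam v \<mu> x" by blast
  define g where "g = (\<lambda>\<omega>. (if \<omega> \<in> S then f \<omega> else 0) + (if \<omega> = \<mu> then cscale c x else 0))"
  have "g \<omega> \<in> descent_space r E lam v \<omega>" for \<omega>
  proof -
    have "(if \<omega> \<in> S then f \<omega> else 0) \<in> descent_space r E lam v \<omega>"
      using f(2) by (simp add: descent_space_def cf.span_zero)
    moreover have "(if \<omega> = \<mu> then cscale c x else 0) \<in> descent_space r E lam v \<omega>"
      using \<mu> by (simp add: descent_space_def cf.span_zero cf.span_scale cf.span_base)
    ultimately show ?thesis unfolding g_def descent_space_def by (rule cf.span_add)
  qed
  moreover have "(\<Sum>\<omega>\<in>insert \<mu> S. g \<omega>) = cscale c x + y"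
  proof -
    have "(\<Sum>\<omega>\<in>insert \<mu> S. g \<omega>) = (\<Sum>\<omega>\<in>insert \<mu> S. if \<omega> \<in> S then f \<omega> else 0) + (\<Sum>\<omega>\<in>insert \<mu> S. if \<omega> = \<mu> then cscale c x else 0)"
      unfolding g_def by (rule sum.distrib)
    also have "(\<Sum>\<omega>\<in>insert \<mu> S. if \<omega> \<in> S then f \<omega> else 0) = (\<Sum>\<omega>\<in>S. f \<omega>)"
      using f(1) by (intro sum.mono_neutral_cong_right) auto
    finally show ?thesis using f by (simp add: add.commute)
  qed
  moreover have "\<forall>\<omega>\<in>insert \<mu> S. \<forall>i\<ge>r. \<omega> i = lam i" using f(4) descends_outside[OF \<mu>] by simp
  ultimately show ?case using f(1) by (intro exI[of _ "insert \<mu> S"] exI[of _ g]) auto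
qed

text \<open>A weight vector in the image of the generated module is the image of a vector of the
  same weight. Used for projections, and for the identity, where it describes the weight spaces of
  the generated module.\<close>

lemma intertwiner_weight_component:
  assumes "gl_action r E" "gl_action r E'" and v: "weight_vector r E lam v"
    and hadd: "\<And>x y. h (x + y) = h x + h y"
    and hE: "\<And>a b x. \<lbrakk>a < r; b < r\<rbrakk> \<Longrightarrow> h (E a b x) = E' a b (h x)"
    and hs: "\<And>c x. h (cscale c x) = cscale c (h x)"
    and z: "z \<in> cyclic r E lam v" and w: "weight_vector r E' \<mu> (h z)" and \<mu>: "\<And>i. i \<ge> r \<Longrightarrow> \<mu> i = lam i"
  shows "\<exists>z' \<in> descent_space r E lam v \<mu>. h z' = h z"
proof -
  interpret A: gl_action r E by fact
  interpret B: gl_action r E' by fact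
  obtain S f where f: "finite S" "\<And>\<omega>. f \<omega> \<in> descent_space r E lam v \<omega>" "z = (\<Sum>\<omega>\<in>S. f \<omega>)"
    "\<forall>\<omega>\<in>S. \<forall>i\<ge>r. \<omega> i = lam i" using cyclic_decomposition[OF z] by blast
  have h0: "h 0 = 0" using hadd[of 0 0] by simp
  have hsum: "h (\<Sum>i\<in>I. k i) = (\<Sum>i\<in>I. h (k i))" for I and k :: "(nat \<Rightarrow> int) \<Rightarrow> _"
    by (induction I rule: infinite_finite_induct) (simp_all add: h0 hadd)
  define g where "g = (\<lambda>\<omega>. (if \<omega> \<in> S then f \<omega> else 0))"
  have g: "g \<omega> \<in> descent_space r E lam v \<omega>" for \<omega>
    using f(2) by (simp add: g_def descent_space_def cf.span_zero)
  have hg: "weight_vector r E' \<omega> (h (g \<omega>))" for \<omega>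
    using A.descent_space_weight[OF v g[of \<omega>]] by (auto simp: weight_vector_def hE[symmetric] hs)
  define k where "k = (\<lambda>\<omega>. h (g \<omega>) - (if \<omega> = \<mu> then h z else 0))"
  have "(\<Sum>\<omega>\<in>insert \<mu> S. g \<omega>) = z" unfolding f(3) g_def
    using f(1) by (intro sum.mono_neutral_cong_right) auto
  then have "(\<Sum>\<omega>\<in>insert \<mu> S. k \<omega>) = 0"
    using f(1) by (simp add: k_def sum_subtractf hsum[symmetric] del: sum.insert)
  moreover have "weight_vector r E' \<omega> (k \<omega>)" for \<omega>
    using cf.subspace_diff[OF B.subspace_weight, of "h (g \<omega>)" \<omega> "if \<omega> = \<mu> then h z else 0"] hg w
      cf.subspace_0[OF B.subspace_weight] by (auto simp: k_def)
  moreover have "\<omega> = \<omega>'" if "\<omega> \<in> insert \<mu> S" "\<omega>' \<in> insert \<mu> S" "\<forall>c<r. \<omega> c = \<omega>' c" for \<omega> \<omega>'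
  proof
    fix i
    have "\<nu> i = lam i" if "\<nu> \<in> insert \<mu> S" "\<not> i < r" for \<nu> using that f(4) \<mu> by auto
    then show "\<omega> i = \<omega>' i" using that by (cases "i < r") (simp, metis)
  qed
  ultimately have "k \<mu> = 0" using f(1) B.weight_vectors_independent[of "insert \<mu> S" k \<mu>] by auto
  then show ?thesis using g[of \<mu>] by (auto simp: k_def)
qed

section \<open>Comparison with an irreducible module\<close>

text \<open>Vectors of a direct sum are functions on a sum type. The projections are constants rather than
  compositions with \<open>Inl\<close> and \<open>Inr\<close>, so that simplification does not turn them into abstractions.\<close>

definition lpart :: "('i + 'j \<Rightarrow> complex) \<Rightarrow> 'i \<Rightarrow> complex" where "lpart z = z \<circ> Inl"
definition rpart :: "('i + 'j \<Rightarrow> complex) \<Rightarrow> 'j \<Rightarrow> complex" where "rpart z = z \<circ> Inr"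
definition dsum :: "('i \<Rightarrow> complex) \<Rightarrow> ('j \<Rightarrow> complex) \<Rightarrow> 'i + 'j \<Rightarrow> complex" where "dsum x y = case_sum x y"

lemma parts_join [simp]: "lpart (dsum x y) = x" "rpart (dsum x y) = y"
  by (simp_all add: lpart_def rpart_def dsum_def fun_eq_iff)

lemma sum_type_eqI: "lpart z = lpart z' \<Longrightarrow> rpart z = rpart z' \<Longrightarrow> z = z'"
  by (rule ext, rename_tac i, case_tac i) (auto simp: fun_eq_iff lpart_def rpart_def)

lemma parts_linear [simp]:
  "lpart (x + y) = lpart x + lpart y" "rpart (x + y) = rpart x + rpart y"
  "lpart (x - y) = lpart x - lpart y" "rpart (x - y) = rpart x - rpart y"
  "lpart (cscale c x) = cscale c (lpart x)" "rpart (cscale c x) = cscale c (rpart x)"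
  "lpart 0 = 0" "rpart 0 = 0"
  by (simp_all add: fun_eq_iff pointwise lpart_def rpart_def)

lemma parts_sum: "lpart (\<Sum>i\<in>I. f i) = (\<Sum>i\<in>I. lpart (f i))" "rpart (\<Sum>i\<in>I. f i) = (\<Sum>i\<in>I. rpart (f i))"
  by (induction I rule: infinite_finite_induct) simp_all

definition pair_op where
  "pair_op E E' a b z = dsum (E a b (lpart z)) (E' a b (rpart z))"

lemma parts_pair_op [simp]:
  "lpart (pair_op E E' a b z) = E a b (lpart z)" "rpart (pair_op E E' a b z) = E' a b (rpart z)"
  by (simp_all add: pair_op_def)

lemma pair_action:
  assumes "gl_action r E" "gl_action r E'"
  shows "gl_action r (pair_op E E')"
proof -
  interpret A: gl_action r E by fact
  interpret B: gl_action r E' by fact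
  show ?thesis
  proof
    fix a b c d :: nat and x y k
    assume ab: "a < r" "b < r"
    show "pair_op E E' a b (x + y) = pair_op E E' a b x + pair_op E E' a b y"
      "pair_op E E' a b (cscale k x) = cscale k (pair_op E E' a b x)"
      by (rule sum_type_eqI; simp add: A.add B.add A.scale B.scale ab)+
    assume cd: "c < r" "d < r"
    show "pair_op E E' a b (pair_op E E' c d x) = pair_op E E' c d (pair_op E E' a b x) +
        (if b = c then pair_op E E' a d x else 0) - (if a = d then pair_op E E' c b x else 0)"
      by (rule sum_type_eqI)
        (simp_all add: A.bracket[OF ab cd, of "lpart x"] B.bracket[OF ab cd, of "rpart x"])
  qed
qed

lemma descends_pair_left:
  "descends r (pair_op E E') lam z0 \<omega> z \<Longrightarrow> descends r E lam (lpart z0) \<omega> (lpart z)"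
  by (induction rule: descends.induct) (simp_all only: parts_pair_op descends.intros)

lemma descends_pair_right:
  "descends r (pair_op E E') lam z0 \<omega> z \<Longrightarrow> descends r E' lam (rpart z0) \<omega> (rpart z)"
  by (induction rule: descends.induct) (simp_all only: parts_pair_op descends.intros)

lemma descent_space_pair_right:
  assumes "z \<in> descent_space r (pair_op E E') lam z0 \<omega>"
  shows "rpart z \<in> descent_space r E' lam (rpart z0) \<omega>"
  using assms unfolding descent_space_def
proof (induction rule: cf.span_induct_alt)
  case base
  then show ?case by (simp add: cf.span_zero)
next
  case (step c x y)
  then have "rpart x \<in> cf.span {x. descends r E' lam (rpart z0) \<omega> x}"
    by (intro cf.span_base) (simp add: descends_pair_right)
  then show ?case using step by (simp add: cf.span_add cf.span_scale)
qed

text \<open>The vectors of weight \<open>\<mu>\<close> in the irreducible module lift to the module generated by the pair of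
  highest weight vectors, and the other projection is injective there. Hence independent vectors of
  weight \<open>\<mu>\<close> in \<open>V\<close> yield as many independent vectors in the span of \<open>T\<close>.\<close>

lemma multiplicity_le_descent:
  assumes EE: "gl_action r E" "gl_action r E'"
    and v: "hw_vector r E lam v" and v': "hw_vector r E' lam v'"
    and V: "invariant r E V" "v \<in> V"
    and irr: "\<And>W. \<lbrakk>invariant r E W; W \<subseteq> V\<rbrakk> \<Longrightarrow> W = {0} \<or> W = V"
    and \<mu>: "\<And>i. i \<ge> r \<Longrightarrow> \<mu> i = lam i"
    and B: "cf.independent B" "B \<subseteq> {x \<in> V. weight_vector r E \<mu> x}"
    and T: "finite T" "descent_space r E' lam v' \<mu> \<subseteq> cf.span T"
  shows "finite B \<and> card B \<le> card T"
proof -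
  interpret A: gl_action r E by fact
  interpret B: gl_action r E' by fact
  let ?P = "pair_op E E'" and ?u = "dsum v v'"
  let ?M = "cyclic r ?P lam ?u"
  have P: "gl_action r ?P" by (rule pair_action[OF EE])
  then interpret P: gl_action r ?P .
  have u0: "weight_vector r ?P lam ?u"
    unfolding weight_vector_def
    by (intro allI impI sum_type_eqI) (use v v' in \<open>simp_all add: hw_vector_def weight_vector_def\<close>)
  have u: "hw_vector r ?P lam ?u"
    unfolding hw_vector_def
  proof (intro conjI allI impI)
    have "lpart ?u \<noteq> 0" using v by (simp add: hw_vector_def)
    then show "?u \<noteq> 0" using parts_linear(7) by metis
    show "weight_vector r ?P lam ?u" by (rule u0)
    show "?P a b ?u = 0" if "a < b" "b < r" for a b
      by (rule sum_type_eqI) (use v v' that in \<open>simp_all add: hw_vector_def\<close>)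
  qed
  have M: "invariant r ?P ?M" by (rule P.cyclic_invariant[OF u])
  then have Msub: "cf.subspace ?M" and ME: "\<And>a b z. \<lbrakk>a < r; b < r; z \<in> ?M\<rbrakk> \<Longrightarrow> ?P a b z \<in> ?M"
    by (auto simp: invariant_def)
  have Vsub: "cf.subspace V" and VE: "\<And>a b z. \<lbrakk>a < r; b < r; z \<in> V\<rbrakk> \<Longrightarrow> E a b z \<in> V"
    using V by (auto simp: invariant_def)
  have uM: "?u \<in> ?M" unfolding cyclic_def by (rule cf.span_base) (auto intro: descends.top)
  have dV: "descends r E lam v \<omega> x \<Longrightarrow> x \<in> V" for \<omega> x
    by (induction rule: descends.induct) (use V VE in auto)
  have "?M \<subseteq> {z. lpart z \<in> V}" unfolding cyclic_def
  proof (rule cf.span_minimal)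
    show "{z. \<exists>\<omega>. descends r ?P lam ?u \<omega> z} \<subseteq> {z. lpart z \<in> V}"
    proof clarify
      fix z \<omega> assume "descends r ?P lam ?u \<omega> z"
      from dV[of \<omega> "lpart z"] descends_pair_left[OF this] show "lpart z \<in> V" by simp
    qed
    show "cf.subspace {z. lpart z \<in> V}"
      using Vsub by (auto simp: cf.subspace_def)
  qed
  then have MV: "lpart z \<in> V" if "z \<in> ?M" for z using that by blast
  \<comment> \<open>The first projection is onto, because its image is a submodule that contains \<open>v\<close>.\<close>
  define I where "I = lpart ` ?M"
  have "invariant r E I" unfolding invariant_def
  proof (intro conjI allI impI ballI)
    show "cf.subspace I"
    proof (rule cf.subspaceI)
      show "0 \<in> I" unfolding I_def using cf.subspace_0[OF Msub] by (auto intro!: image_eqI[of _ _ 0])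
      show "x + y \<in> I" if "x \<in> I" "y \<in> I" for x y
        using that cf.subspace_add[OF Msub] unfolding I_def by (auto simp: parts_linear(1)[symmetric] simp del: parts_linear)
      show "cscale c x \<in> I" if "x \<in> I" for c x
        using that cf.subspace_scale[OF Msub] unfolding I_def by (auto simp: parts_linear(5)[symmetric] simp del: parts_linear)
    qed
    show "E a b x \<in> I" if "a < r" "b < r" "x \<in> I" for a b x
    proof -
      obtain z where "z \<in> ?M" "x = lpart z" using \<open>x \<in> I\<close> by (auto simp: I_def)
      then show ?thesis unfolding I_def
        using ME[of a b z] \<open>a < r\<close> \<open>b < r\<close> by (intro image_eqI[of _ _ "?P a b z"]) simp_all
    qed
  qed
  moreover have "v \<in> I" using uM unfolding I_def by (auto intro!: image_eqI[of _ _ ?u])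
  ultimately have IV: "I = V" using irr[of I] MV v by (auto simp: I_def hw_vector_def)
  \<comment> \<open>\<open>N\<close> is the kernel of the second projection, seen as a submodule of \<open>V\<close>.\<close>
  define N where "N = {x. dsum x 0 \<in> ?M}"
  have NV: "N \<subseteq> V"
  proof
    fix x assume "x \<in> N"
    then show "x \<in> V" using MV[of "dsum x 0"] by (simp add: N_def)
  qed
  have cs: "dsum (0 :: 'a \<Rightarrow> complex) (0 :: 'b \<Rightarrow> complex) = 0"
    "\<And>x y. dsum (x + y :: 'a \<Rightarrow> complex) (0 :: 'b \<Rightarrow> complex) = dsum x 0 + dsum y 0"
    "\<And>x c. dsum (cscale c x :: 'a \<Rightarrow> complex) (0 :: 'b \<Rightarrow> complex) = cscale c (dsum x 0)"
    by (auto intro!: sum_type_eqI)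
  have "invariant r E N" unfolding invariant_def
  proof (intro conjI allI impI ballI)
    show "cf.subspace N"
      using Msub unfolding N_def cf.subspace_def by (auto simp: cs)
    show "E a b x \<in> N" if "a < r" "b < r" "x \<in> N" for a b x
    proof -
      have "?P a b (dsum x 0) = dsum (E a b x) 0"
        by (rule sum_type_eqI) (use that in \<open>simp_all add: B.zero\<close>)
      then show ?thesis using that ME[of a b "dsum x 0"] by (auto simp: N_def)
    qed
  qed
  moreover have "v \<notin> N"
  proof
    assume "v \<in> N"
    then have vM: "dsum v 0 \<in> ?M" by (simp add: N_def)
    have "weight_vector r ?P lam (dsum v 0)"
      unfolding weight_vector_def
      by (intro allI impI sum_type_eqI) (use v in \<open>simp_all add: hw_vector_def weight_vector_def B.zero\<close>)
    then have "dsum v 0 \<in> descent_space r ?P lam ?u lam"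
      using intertwiner_weight_component[OF P P u0, where h = "\<lambda>x. x" and \<mu> = lam and z = "dsum v 0"] vM by auto
    then obtain c where c: "dsum v 0 = cscale c ?u"
      by (auto simp: descent_space_top cf.span_singleton)
    from arg_cong[OF c, of "\<lambda>z. rpart z"] v' have "c = 0" by (auto simp: hw_vector_def)
    with arg_cong[OF c, of "\<lambda>z. lpart z"] v show False by (auto simp: hw_vector_def)
  qed
  ultimately have N0: "N = {0}" using irr[of N] NV V by auto
  have inj: "lpart z = 0" if "z \<in> ?M" "rpart z = 0" for z
  proof -
    have "z = dsum (lpart z) 0" by (rule sum_type_eqI) (use that in simp_all)
    then have "lpart z \<in> N" using that by (simp add: N_def)
    then show ?thesis using N0 by simp
  qed
  have "\<forall>x\<in>B. \<exists>z. z \<in> descent_space r ?P lam ?u \<mu> \<and> lpart z = x"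
  proof
    fix x assume x: "x \<in> B"
    with B IV obtain z where z: "z \<in> ?M" "lpart z = x" by (auto simp: I_def)
    have "\<exists>z'\<in>descent_space r ?P lam ?u \<mu>. lpart z' = lpart z"
      by (rule intertwiner_weight_component[OF P EE(1) u0 _ _ _ z(1)]) (use z x B \<mu> in auto)
    then show "\<exists>z. z \<in> descent_space r ?P lam ?u \<mu> \<and> lpart z = x" using z(2) by auto
  qed
  from bchoice[OF this] obtain Z where
    Z: "\<And>x. x \<in> B \<Longrightarrow> Z x \<in> descent_space r ?P lam ?u \<mu>" "\<And>x. x \<in> B \<Longrightarrow> lpart (Z x) = x"
    by blast
  have "descent_space r ?P lam ?u \<mu> \<subseteq> ?M"
    unfolding descent_space_def cyclic_def by (rule cf.span_mono) auto
  then have ZM: "Z x \<in> ?M" if "x \<in> B" for x using Z that by blast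
  define f where "f = (\<lambda>x. rpart (Z x))"
  have "inj_on f B"
  proof (rule inj_onI)
    fix x y assume xy: "x \<in> B" "y \<in> B" "f x = f y"
    then have "lpart (Z x - Z y) = 0"
      by (intro inj cf.subspace_diff[OF Msub] ZM) (auto simp: f_def)
    then show "x = y" using Z(2) xy by simp
  qed
  have "cf.independent (f ` B)"
    unfolding cf.independent_explicit_module
  proof (intro allI impI)
    fix t u y assume t: "finite t" "t \<subseteq> f ` B" "(\<Sum>y\<in>t. cscale (u y) y) = 0" "y \<in> t"
    obtain s where s: "s \<subseteq> B" "t = f ` s" using t(2) by (rule subset_imageE)
    have inj_s: "inj_on f s" using \<open>inj_on f B\<close> s(1) by (rule inj_on_subset)
    have fs: "finite s" using t(1) unfolding s(2) by (rule finite_imageD[OF _ inj_s])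
    let ?z = "\<Sum>x\<in>s. cscale (u (f x)) (Z x)"
    have "rpart ?z = 0"
      using t(3) unfolding s(2) sum.reindex[OF inj_s] parts_sum by (simp add: f_def)
    moreover have "?z \<in> ?M"
      using s ZM by (auto intro!: cf.subspace_sum[OF Msub] cf.subspace_scale[OF Msub])
    ultimately have "lpart ?z = 0" using inj[of ?z] by simp
    moreover have "lpart ?z = (\<Sum>x\<in>s. cscale (u (f x)) x)"
      unfolding parts_sum using Z(2) s by (intro sum.cong) auto
    ultimately have 0: "(\<Sum>x\<in>s. cscale (u (f x)) x) = 0" by simp
    have "u (f x) = 0" if "x \<in> s" for x
      by (rule cf.independentD[OF B(1) fs s(1) 0 that])
    then show "u y = 0" using t(4) s(2) by auto
  qed
  moreover have "f ` B \<subseteq> cf.span T"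
  proof clarify
    fix x assume "x \<in> B"
    then have "f x \<in> descent_space r E' lam v' \<mu>"
      using descent_space_pair_right[OF Z(1)[of x]] by (simp add: f_def)
    then show "f x \<in> cf.span T" using T(2) by blast
  qed
  ultimately have "finite (f ` B) \<and> card (f ` B) \<le> card T"
    using cf.independent_span_bound[OF T(1)] by simp
  then show ?thesis using card_image[OF \<open>inj_on f B\<close>] finite_imageD[OF _ \<open>inj_on f B\<close>] by simp
qed

section \<open>Tensor powers of the natural module\<close>

text \<open>The operator of a matrix unit on a tensor power, written on coefficients of words: the
  coefficient of \<open>w\<close> collects those of the words in which one occurrence of \<open>a\<close> was \<open>b\<close> before.\<close>

definition word_op :: "nat \<Rightarrow> nat \<Rightarrow> (nat list \<Rightarrow> complex) \<Rightarrow> nat list \<Rightarrow> complex" where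
  "word_op a b g w = (\<Sum>p<length w. if w ! p = a then g (w[p := b]) else 0)"

lemma word_action: "gl_action r word_op"
proof
  fix a b c d and x y :: "nat list \<Rightarrow> complex" and k
  show "word_op a b (x + y) = word_op a b x + word_op a b y"
    by (rule ext) (simp add: word_op_def pointwise sum.distrib[symmetric] if_distrib cong: if_cong)
  show "word_op a b (cscale k x) = cscale k (word_op a b x)"
    by (rule ext) (simp add: word_op_def pointwise sum_distrib_left if_distrib cong: if_cong)
  \<comment> \<open>Two replacements at different positions commute; two at the same position merge into one.\<close>
  have main: "word_op a b (word_op c d x) w =
      (\<Sum>p<length w. \<Sum>q<length w. if p \<noteq> q \<and> w ! p = a \<and> w ! q = c then x (w[p := b, q := d]) else 0)
        + (if b = c then word_op a d x w else 0)" for a b c d w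
  proof -
    have "(if w ! p = a then word_op c d x (w[p := b]) else 0) =
        (\<Sum>q<length w. if p \<noteq> q \<and> w ! p = a \<and> w ! q = c then x (w[p := b, q := d]) else 0) +
        (if b = c then if w ! p = a then x (w[p := d]) else 0 else 0)" if p: "p < length w" for p
    proof -
      have "(if w ! p = a then word_op c d x (w[p := b]) else 0) =
        (\<Sum>q<length w. (if p \<noteq> q \<and> w ! p = a \<and> w ! q = c then x (w[p := b, q := d]) else 0) +
          (if q = p then if b = c then if w ! p = a then x (w[p := d]) else 0 else 0 else 0))"
      proof (cases "w ! p = a")
        case True
        have "(if w[p := b] ! q = c then x (w[p := b, q := d]) else 0) =
          (if p \<noteq> q \<and> w ! p = a \<and> w ! q = c then x (w[p := b, q := d]) else 0) +
          (if q = p then if b = c then if w ! p = a then x (w[p := d]) else 0 else 0 else 0)"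
          if "q < length w" for q
          using p True that by (auto simp: nth_list_update)
        then show ?thesis using True unfolding word_op_def by (auto intro!: sum.cong simp del: sum.distrib)
      qed (simp add: sum.neutral)
      also have "\<dots> = (\<Sum>q<length w. if p \<noteq> q \<and> w ! p = a \<and> w ! q = c then x (w[p := b, q := d]) else 0) +
        (if b = c then if w ! p = a then x (w[p := d]) else 0 else 0)"
        using p by (simp add: sum.distrib)
      finally show ?thesis .
    qed
    then have "word_op a b (word_op c d x) w = (\<Sum>p<length w. 
        (\<Sum>q<length w. if p \<noteq> q \<and> w ! p = a \<and> w ! q = c then x (w[p := b, q := d]) else 0) +
        (if b = c then if w ! p = a then x (w[p := d]) else 0 else 0))"
      unfolding word_op_def[of a b "word_op c d x"] by (intro sum.cong) auto
    then show ?thesis by (simp add: sum.distrib word_op_def)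
  qed
  show "word_op a b (word_op c d x) = word_op c d (word_op a b x) +
      (if b = c then word_op a d x else 0) - (if a = d then word_op c b x else 0)"
  proof
    fix w
    let ?S = "\<lambda>a b c d. \<Sum>p<length w. \<Sum>q<length w.
      if p \<noteq> q \<and> w ! p = a \<and> w ! q = c then x (w[p := b, q := d]) else 0"
    have S: "?S a b c d = ?S c d a b"
      by (subst sum.swap) (intro sum.cong refl if_cong, auto simp: list_update_swap)
    show "word_op a b (word_op c d x) w = (word_op c d (word_op a b x) +
      (if b = c then word_op a d x else 0) - (if a = d then word_op c b x else 0)) w"
      unfolding pointwise main S by (cases "b = c"; cases "a = d"; simp add: pointwise)
  qed
qed

text \<open>The antisymmetric tensor of the first \<open>h\<close> basis vectors. The function \<open>f\<close> continues the word by
  the identity, because the library attaches signs to permutations of the whole type.\<close>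

definition column_vector :: "nat \<Rightarrow> nat list \<Rightarrow> complex" where
  "column_vector h w = (let f = (\<lambda>i. if i < h then w ! i else i) in
     if length w = h \<and> f permutes {..<h} then of_int (sign f) else 0)"

text \<open>If a word contributes, then \<open>a\<close> occurs exactly twice in it, and the two possible replacements
  differ by a transposition, so they cancel.\<close>

lemma column_vector_raised: "a < b \<Longrightarrow> word_op a b (column_vector h) = 0"
proof
  fix w assume ab: "a < b"
  let ?t = "\<lambda>p. if w ! p = a then column_vector h (w[p := b]) else 0"
  show "word_op a b (column_vector h) w = 0 w"
  proof (cases "\<exists>p<length w. ?t p \<noteq> 0")
    case False
    then have "(\<Sum>p<length w. ?t p) = 0" by (intro sum.neutral) auto
    then show ?thesis by (simp add: word_op_def pointwise)
  next
    case True
    then obtain p where p: "p < length w" "w ! p = a" "column_vector h (w[p := b]) \<noteq> 0"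
      by (auto split: if_splits)
    define f where "f = (\<lambda>i. if i < h then w[p := b] ! i else i)"
    from p(3) have f: "f permutes {..<h}" and h: "length w = h"
      by (auto simp: column_vector_def f_def Let_def split: if_splits)
    have fp: "f p = b" using p h by (simp add: f_def)
    then have "b < h" using permutes_in_image[OF f, of p] p h by simp
    then obtain q where q: "q < h" "f q = a"
      using permutes_image[OF f] ab by (metis (mono_tags, lifting) imageE lessThan_iff less_trans)
    have pq: "p \<noteq> q" using fp q ab by auto
    then have wq: "w ! q = a" using q h by (auto simp: f_def)
    have only: "p' \<in> {p, q}" if "p' < h" "w ! p' = a" for p'
    proof (rule ccontr)
      assume "p' \<notin> {p, q}"
      then have "f p' = f q" using that q h by (auto simp: f_def)
      then show False using permutes_inj[OF f] \<open>p' \<notin> {p, q}\<close> by (auto dest: injD)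
    qed
    have "(\<lambda>i. if i < h then w[q := b] ! i else i) = f \<circ> transpose p q"
      using p q h pq wq by (auto simp: f_def fun_eq_iff nth_list_update transpose_def)
    moreover have "f \<circ> transpose p q permutes {..<h}"
      using f p q h by (intro permutes_compose permutes_swap_id) auto
    moreover have "sign (f \<circ> transpose p q) = - sign f"
      using pq permutation_permutes[of f] f by (subst sign_compose) (auto simp: sign_swap_id permutation_swap_id)
    ultimately have swap: "column_vector h (w[q := b]) = - column_vector h (w[p := b])"
      using h f by (simp add: column_vector_def Let_def f_def[symmetric])
    have "(\<Sum>p<length w. ?t p) = (\<Sum>p\<in>{p, q}. ?t p)"
      using only p q h by (intro sum.mono_neutral_right) auto
    also have "\<dots> = 0" using pq p wq swap by simp
    finally show ?thesis by (simp add: word_op_def pointwise)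
  qed
qed

lemma count_list_distinct: "distinct w \<Longrightarrow> count_list w c = (if c \<in> set w then 1 else 0)"
  by (induction w) auto

lemma column_vector_count: "column_vector h w \<noteq> 0 \<Longrightarrow> count_list w c = (if c < h then 1 else 0)"
proof -
  assume "column_vector h w \<noteq> 0"
  define f where "f = (\<lambda>i. if i < h then w ! i else i)"
  have f: "f permutes {..<h}" "length w = h"
    using \<open>column_vector h w \<noteq> 0\<close> by (auto simp: column_vector_def f_def Let_def split: if_splits)
  have w: "w = map f [0..<h]" using f(2) by (intro nth_equalityI) (auto simp: f_def)
  have "distinct w" using permutes_inj_on[OF f(1)] by (simp add: w distinct_map atLeast0LessThan)
  moreover have "set w = {..<h}" using permutes_image[OF f(1)] by (simp add: w atLeast0LessThan)
  ultimately show ?thesis by (simp add: count_list_distinct)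
qed

lemma column_vector_identity: "column_vector h [0..<h] = 1"
proof -
  have "(\<lambda>i. if i < h then [0..<h] ! i else i) = id" by auto
  then show ?thesis by (simp add: column_vector_def permutes_id)
qed

lemma count_list_update:
  "p < length w \<Longrightarrow> int (count_list (w[p := b]) c) =
     int (count_list w c) - (if w ! p = c then 1 else 0) + (if b = c then 1 else 0)"
proof (induction w arbitrary: p)
  case (Cons x w)
  show ?case
  proof (cases p)
    case (Suc p')
    then show ?thesis using Cons.IH[of p'] Cons.prems by (simp split: if_splits)
  qed simp
qed simp

text \<open>The Leibniz rule for a tensor product. The support of \<open>f\<close> fixes where a word is cut.\<close>

lemma word_op_append:
  assumes "\<And>u. length u \<noteq> h \<Longrightarrow> f u = 0"
  shows "word_op a b (\<lambda>w. f (take h w) * g (drop h w)) w =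
    word_op a b f (take h w) * g (drop h w) + f (take h w) * word_op a b g (drop h w)"
proof (cases "h \<le> length w")
  case False
  then show ?thesis using assms by (simp add: word_op_def)
next
  case True
  let ?t = "\<lambda>p. if w ! p = a then f (take h (w[p := b])) * g (drop h (w[p := b])) else 0"
  have "(\<Sum>p<length w. ?t p) = (\<Sum>p<h. ?t p) + (\<Sum>p=h..<length w. ?t p)"
    using sum.atLeastLessThan_concat[of 0 h "length w" ?t] True by (simp add: atLeast0LessThan)
  also have "(\<Sum>p<h. ?t p) = (\<Sum>p<h. if w ! p = a then f ((take h w)[p := b]) else 0) * g (drop h w)"
    unfolding sum_distrib_right by (intro sum.cong) (auto simp: take_update_swap)
  also have "(\<Sum>p=h..<length w. ?t p) = (\<Sum>p<length w - h. ?t (h + p))"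
    unfolding sum.atLeastLessThan_shift_0[of ?t h] by (simp add: atLeast0LessThan)
  also have "\<dots> = f (take h w) * (\<Sum>p<length w - h. if w ! (h + p) = a then g ((drop h w)[p := b]) else 0)"
    unfolding sum_distrib_left by (intro sum.cong) (auto simp: drop_update_swap)
  finally show ?thesis using True
    by (simp add: word_op_def add.commute min_absorb2)
qed

lemma partition_nonzero_iff:
  assumes "is_partition lam"
  shows "lam i \<noteq> 0 \<longleftrightarrow> i < partition_length lam"
proof -
  let ?S = "{i. lam i \<noteq> 0}"
  have fin: "finite ?S" and anti: "antimono lam" using assms by (auto simp: is_partition_def)
  have down: "lam j \<noteq> 0" if "lam i \<noteq> 0" "j \<le> i" for i j
    using antimonoD[OF anti that(2)] that(1) by simp
  obtain h where h: "?S = {..<h}"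
  proof (cases "?S = {}")
    case True
    then show ?thesis using that[of 0] by simp
  next
    case False
    have "?S = {..<Suc (Max ?S)}"
    proof (intro equalityI subsetI)
      fix j assume "j \<in> {..<Suc (Max ?S)}"
      then show "j \<in> ?S" using down[of "Max ?S" j] Max_in[OF fin False] by auto
    qed (use fin Max_ge in \<open>auto simp: less_Suc_eq_le\<close>)
    then show ?thesis using that by blast
  qed
  then show ?thesis by (auto simp: partition_length_def)
qed

text \<open>Induction on the number of columns: the first column of \<open>lam\<close>, of height the length of \<open>lam\<close>, is
  split off as a factor.\<close>

lemma word_hw_vector_exists:
  assumes "is_partition lam"
  shows "\<exists>g. g \<noteq> 0 \<and> (\<forall>w c. g w \<noteq> 0 \<longrightarrow> count_list w c = lam c) \<and>
    (\<forall>a b. a < b \<longrightarrow> word_op a b g = 0)"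
  using assms
proof (induction "lam 0" arbitrary: lam)
  case 0
  then have lam: "lam c = 0" for c using antimonoD[of lam 0 c] by (simp add: is_partition_def)
  define g :: "nat list \<Rightarrow> complex" where "g = (\<lambda>w. if w = [] then 1 else 0)"
  have "g [] \<noteq> 0" by (simp add: g_def)
  then have "g \<noteq> 0" by (auto simp: pointwise)
  moreover have "word_op a b g = 0" for a b
    by (auto simp: word_op_def g_def fun_eq_iff pointwise intro!: sum.neutral)
  ultimately show ?case by (intro exI[of _ g]) (auto simp: lam g_def split: if_splits)
next
  case (Suc n)
  let ?mu = "\<lambda>i. lam i - 1"
  define h where "h = partition_length lam"
  have h: "lam i \<noteq> 0 \<longleftrightarrow> i < h" for i
    using partition_nonzero_iff[OF Suc.prems] by (simp add: h_def)
  have n: "n = ?mu 0" using Suc.hyps(2) by simp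
  have "antimono ?mu" using Suc.prems by (auto simp: is_partition_def antimono_def diff_le_mono)
  moreover have "finite {i. ?mu i \<noteq> 0}"
    by (rule finite_subset[of _ "{i. lam i \<noteq> 0}"]) (use Suc.prems in \<open>auto simp: is_partition_def\<close>)
  ultimately have mu: "is_partition ?mu" by (simp add: is_partition_def)
  obtain g where g: "g \<noteq> 0" "\<And>w c. g w \<noteq> 0 \<Longrightarrow> count_list w c = ?mu c"
    "\<And>a b. a < b \<Longrightarrow> word_op a b g = 0"
    using Suc.hyps(1)[OF n mu] by blast
  define f where "f = (\<lambda>w. column_vector h (take h w) * g (drop h w))"
  obtain w0 where "g w0 \<noteq> 0" using g(1) by (auto simp: fun_eq_iff pointwise)
  then have "f ([0..<h] @ w0) \<noteq> 0" by (simp add: f_def column_vector_identity)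
  then have "f \<noteq> 0" by (auto simp: pointwise)
  moreover have "count_list w c = lam c" if "f w \<noteq> 0" for w c
  proof -
    have "count_list w c = count_list (take h w) c + count_list (drop h w) c"
      by (metis append_take_drop_id count_list_append)
    then show ?thesis using that g(2) column_vector_count h[of c] by (auto simp: f_def)
  qed
  moreover have "word_op a b f = 0" if "a < b" for a b
  proof
    fix w
    show "word_op a b f w = 0 w"
      using column_vector_raised[OF that, of h] g(3)[OF that] unfolding f_def
      by (subst word_op_append) (auto simp: column_vector_def pointwise)
  qed
  ultimately show ?case by blast
qed

definition words :: "nat \<Rightarrow> nat \<Rightarrow> nat list set" where
  "words r n = {w. set w \<subseteq> {..<r} \<and> length w = n}"

definition word_weight :: "nat list \<Rightarrow> nat \<Rightarrow> int" where
  "word_weight w c = int (count_list w c)"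

lemma finite_words: "finite (words r n)"
  unfolding words_def by (rule finite_lists_length_eq) simp

lemma descends_word_weight:
  assumes "\<And>w. g w \<noteq> 0 \<Longrightarrow> word_weight w = lam"
  shows "descends r word_op lam g \<omega> x \<Longrightarrow> x w \<noteq> 0 \<Longrightarrow> word_weight w = \<omega>"
proof (induction arbitrary: w rule: descends.induct)
  case top
  then show ?case using assms by blast
next
  case (lower \<omega> x b a)
  have "\<exists>p<length w. w ! p = a \<and> x (w[p := b]) \<noteq> 0"
  proof (rule ccontr)
    assume "\<not> ?thesis"
    then have "word_op a b x w = 0" unfolding word_op_def by (intro sum.neutral) auto
    then show False using lower.prems by simp
  qed
  then obtain p where p: "p < length w" "w ! p = a" "x (w[p := b]) \<noteq> 0" by blast
  have "\<omega> c = word_weight (w[p := b]) c" for c using lower.IH[OF p(3)] by simp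
  then show ?case using count_list_update[OF p(1), of b] p(2) lower.hyps
    by (auto simp: fun_eq_iff word_weight_def)
qed

lemma word_weight_words:
  assumes "word_weight w = \<omega>" "\<And>c. c \<ge> r \<Longrightarrow> \<omega> c = 0" "(\<Sum>c<r. \<omega> c) = int n"
  shows "w \<in> words r n"
proof -
  have "set w \<subseteq> {..<r}"
  proof
    fix c assume "c \<in> set w"
    then have "\<omega> c \<noteq> 0" using assms(1) by (auto simp: word_weight_def count_list_0_iff)
    then show "c \<in> {..<r}" using assms(2) by (metis lessThan_iff not_le)
  qed
  moreover from this have "int (length w) = int n"
    using assms(1,3) sum_count_set[of w "{..<r}"] by (auto simp: word_weight_def simp flip: of_nat_sum)
  ultimately show ?thesis by (simp add: words_def)
qed

text \<open>A lowering operator changes the letter counts as it changes the weight, so vectors of weight \<open>\<omega>\<close>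
  are supported on words with letter counts \<open>\<omega>\<close>.\<close>

lemma word_descent_space:
  assumes "\<And>w. g w \<noteq> 0 \<Longrightarrow> word_weight w = lam"
    "\<And>c. c \<ge> r \<Longrightarrow> lam c = 0" "(\<Sum>c<r. lam c) = int n"
  shows "descent_space r word_op lam g \<omega> \<subseteq> cf.span (indicator_at ` {w \<in> words r n. word_weight w = \<omega>})"
  unfolding descent_space_def
proof (rule cf.span_minimal)
  show "{x. descends r word_op lam g \<omega> x} \<subseteq> cf.span (indicator_at ` {w \<in> words r n. word_weight w = \<omega>})"
  proof clarify
    fix x assume x: "descends r word_op lam g \<omega> x"
    show "x \<in> cf.span (indicator_at ` {w \<in> words r n. word_weight w = \<omega>})"
    proof (rule finitely_supported_in_span)
      show "finite {w \<in> words r n. word_weight w = \<omega>}" using finite_words by simp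
      fix w assume "x w \<noteq> 0"
      then have "word_weight w = \<omega>" using descends_word_weight[of g lam, OF assms(1) x] by blast
      then show "w \<in> {w \<in> words r n. word_weight w = \<omega>}"
        using word_weight_words[of w \<omega> r n] descends_outside[OF x] descends_total[OF x] assms(2,3) by auto
    qed
  qed
qed simp

section \<open>Matrix representations as modules of functions\<close>

definition mat_op :: "nat \<Rightarrow> complex mat \<Rightarrow> (nat \<Rightarrow> complex) \<Rightarrow> nat \<Rightarrow> complex" where
  "mat_op d A f = (\<lambda>i. if i < d then \<Sum>j<d. A $$ (i, j) * f j else 0)"

definition elem_mat :: "nat \<Rightarrow> nat \<Rightarrow> nat \<Rightarrow> complex mat" where
  "elem_mat r a b = mat r r (\<lambda>(i, j). if i = a \<and> j = b then 1 else 0)"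

definition rep_op :: "nat \<Rightarrow> nat \<Rightarrow> (complex mat \<Rightarrow> complex mat) \<Rightarrow> nat \<Rightarrow> nat \<Rightarrow> (nat \<Rightarrow> complex) \<Rightarrow> nat \<Rightarrow> complex"
  where "rep_op r d \<rho> a b = mat_op d (\<rho> (elem_mat r a b))"

definition supported :: "nat \<Rightarrow> (nat \<Rightarrow> complex) set" where
  "supported d = {f. \<forall>i\<ge>d. f i = 0}"

definition coords :: "complex vec \<Rightarrow> nat \<Rightarrow> complex" where
  "coords v = (\<lambda>i. if i < dim_vec v then v $ i else 0)"

lemma coords_vec [simp]: "f \<in> supported d \<Longrightarrow> coords (vec d f) = f"
  by (auto simp: coords_def supported_def fun_eq_iff)

lemma vec_coords [simp]: "v \<in> carrier_vec d \<Longrightarrow> vec d (coords v) = v"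
  by (intro eq_vecI) (auto simp: coords_def)

lemma coords_supported [simp]: "v \<in> carrier_vec d \<Longrightarrow> coords v \<in> supported d"
  by (auto simp: coords_def supported_def)

lemma inj_on_coords: "inj_on coords (carrier_vec d)"
  by (rule inj_on_inverseI[of _ "vec d"]) simp

lemma coords_eq_iff: "\<lbrakk>v \<in> carrier_vec d; w \<in> carrier_vec d\<rbrakk> \<Longrightarrow> coords v = coords w \<longleftrightarrow> v = w"
  using inj_on_coords by (auto dest: inj_onD)

lemma coords_zero [simp]: "coords (0\<^sub>v d) = 0"
  by (auto simp: coords_def fun_eq_iff pointwise)

lemma coords_add: "\<lbrakk>v \<in> carrier_vec d; w \<in> carrier_vec d\<rbrakk> \<Longrightarrow> coords (v + w) = coords v + coords w"
  by (auto simp: coords_def fun_eq_iff pointwise)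

lemma coords_smult: "coords (c \<cdot>\<^sub>v v) = cscale c (coords v)"
  by (auto simp: coords_def fun_eq_iff pointwise)

lemma coords_mult:
  "\<lbrakk>A \<in> carrier_mat d d; v \<in> carrier_vec d\<rbrakk> \<Longrightarrow> coords (A *\<^sub>v v) = mat_op d A (coords v)"
  by (auto simp: coords_def mat_op_def fun_eq_iff scalar_prod_def atLeast0LessThan intro!: sum.cong)

lemma subspace_supported: "cf.subspace (supported d)"
  by (rule cf.subspaceI) (auto simp: supported_def pointwise)

lemma mat_op_supported [simp]: "mat_op d A f \<in> supported d"
  by (simp add: mat_op_def supported_def)

lemma mat_op_plus: "mat_op d A (f + g) = mat_op d A f + mat_op d A g"
  by (rule ext) (simp add: mat_op_def pointwise sum.distrib algebra_simps)

lemma mat_op_scale: "mat_op d A (cscale c f) = cscale c (mat_op d A f)"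
  by (rule ext) (simp add: mat_op_def pointwise sum_distrib_left algebra_simps)

lemma mat_op_add_mat:
  "\<lbrakk>A \<in> carrier_mat d d; B \<in> carrier_mat d d\<rbrakk> \<Longrightarrow> mat_op d (A + B) f = mat_op d A f + mat_op d B f"
  by (rule ext) (simp add: mat_op_def pointwise sum.distrib algebra_simps)

lemma mat_op_diff_mat:
  "\<lbrakk>A \<in> carrier_mat d d; B \<in> carrier_mat d d\<rbrakk> \<Longrightarrow> mat_op d (A - B) f = mat_op d A f - mat_op d B f"
  by (rule ext) (simp add: mat_op_def pointwise sum_subtractf algebra_simps)

lemma mat_op_smult_mat:
  "A \<in> carrier_mat d d \<Longrightarrow> mat_op d (c \<cdot>\<^sub>m A) f = cscale c (mat_op d A f)"
  by (rule ext) (simp add: mat_op_def pointwise sum_distrib_left algebra_simps)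

lemma mat_op_mult_mat:
  assumes "A \<in> carrier_mat d d" "B \<in> carrier_mat d d"
  shows "mat_op d (A * B) f = mat_op d A (mat_op d B f)"
proof
  fix i
  show "mat_op d (A * B) f i = mat_op d A (mat_op d B f) i"
  proof (cases "i < d")
    case True
    have "(\<Sum>j<d. (A * B) $$ (i, j) * f j) = (\<Sum>j<d. \<Sum>k<d. A $$ (i, k) * (B $$ (k, j) * f j))"
      using assms True
      by (intro sum.cong) (auto simp: scalar_prod_def atLeast0LessThan sum_distrib_right mult.assoc)
    also have "\<dots> = (\<Sum>k<d. A $$ (i, k) * (\<Sum>j<d. B $$ (k, j) * f j))"
      by (subst sum.swap) (simp add: sum_distrib_left)
    finally show ?thesis using True by (simp add: mat_op_def)
  qed (simp add: mat_op_def)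
qed

lemma elem_mat_carrier [simp]: "elem_mat r a b \<in> carrier_mat r r"
  by (simp add: elem_mat_def)

lemma elem_mat_mult:
  assumes "b < r" "c < r"
  shows "elem_mat r a b * elem_mat r c d = (if b = c then elem_mat r a d else 0\<^sub>m r r)"
proof (rule eq_matI)
  fix i j assume "i < dim_row (if b = c then elem_mat r a d else 0\<^sub>m r r)"
    "j < dim_col (if b = c then elem_mat r a d else 0\<^sub>m r r)"
  then have ij: "i < r" "j < r" by (auto simp: elem_mat_def split: if_splits)
  then have "(elem_mat r a b * elem_mat r c d) $$ (i, j) =
      (\<Sum>k<r. elem_mat r a b $$ (i, k) * elem_mat r c d $$ (k, j))"
    by (simp add: elem_mat_def scalar_prod_def atLeast0LessThan)
  also have "\<dots> = (\<Sum>k<r. if k = b then if i = a \<and> b = c \<and> j = d then 1 else 0 else 0)"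
    using ij by (intro sum.cong) (auto simp: elem_mat_def)
  also have "\<dots> = (if i = a \<and> b = c \<and> j = d then 1 else 0)" using assms by simp
  finally show "(elem_mat r a b * elem_mat r c d) $$ (i, j) = (if b = c then elem_mat r a d else 0\<^sub>m r r) $$ (i, j)"
    using ij by (simp add: elem_mat_def)
qed (auto simp: elem_mat_def)

locale gl_representation =
  fixes r d :: nat and \<rho> :: "complex mat \<Rightarrow> complex mat"
  assumes rep: "gl_rep r d \<rho>"
begin

lemma carrier [simp]: "X \<in> carrier_mat r r \<Longrightarrow> \<rho> X \<in> carrier_mat d d"
  using rep by (simp add: gl_rep_def)

lemma rep_add: "\<lbrakk>X \<in> carrier_mat r r; Y \<in> carrier_mat r r\<rbrakk> \<Longrightarrow> mat_op d (\<rho> (X + Y)) f = mat_op d (\<rho> X) f + mat_op d (\<rho> Y) f"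
  using rep by (simp add: gl_rep_def mat_op_add_mat)

lemma rep_smult: "X \<in> carrier_mat r r \<Longrightarrow> mat_op d (\<rho> (c \<cdot>\<^sub>m X)) f = cscale c (mat_op d (\<rho> X) f)"
  using rep by (simp add: gl_rep_def mat_op_smult_mat)

lemma rep_zero: "mat_op d (\<rho> (0\<^sub>m r r)) f = 0"
proof -
  have "0\<^sub>m r r = (0 :: complex) \<cdot>\<^sub>m 0\<^sub>m r r" by (intro eq_matI) auto
  then show ?thesis using rep_smult[of "0\<^sub>m r r" 0 f] by simp
qed

lemma rep_diff:
  assumes "X \<in> carrier_mat r r" "Y \<in> carrier_mat r r"
  shows "mat_op d (\<rho> (X - Y)) f = mat_op d (\<rho> X) f - mat_op d (\<rho> Y) f"
proof -
  have "X - Y = X + (-1) \<cdot>\<^sub>m Y" using assms by (intro eq_matI) auto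
  then show ?thesis using assms by (simp add: rep_add rep_smult)
qed

lemma rep_bracket:
  assumes "X \<in> carrier_mat r r" "Y \<in> carrier_mat r r"
  shows "mat_op d (\<rho> X) (mat_op d (\<rho> Y) f) =
    mat_op d (\<rho> Y) (mat_op d (\<rho> X) f) + mat_op d (\<rho> (X * Y)) f - mat_op d (\<rho> (Y * X)) f"
proof -
  have "\<rho> (X * Y - Y * X) = \<rho> X * \<rho> Y - \<rho> Y * \<rho> X"
    using rep assms by (simp add: gl_rep_def)
  then have "mat_op d (\<rho> (X * Y - Y * X)) f = mat_op d (\<rho> X * \<rho> Y) f - mat_op d (\<rho> Y * \<rho> X) f"
    using assms mat_op_diff_mat[of "\<rho> X * \<rho> Y" d "\<rho> Y * \<rho> X" f]
    by (simp add: mult_carrier_mat[of _ d d _ d])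
  then have "mat_op d (\<rho> (X * Y)) f - mat_op d (\<rho> (Y * X)) f =
      mat_op d (\<rho> X) (mat_op d (\<rho> Y) f) - mat_op d (\<rho> Y) (mat_op d (\<rho> X) f)"
    using assms by (simp add: rep_diff mat_op_mult_mat mult_carrier_mat[of _ r r _ r])
  then show ?thesis by (simp add: algebra_simps)
qed

sublocale gl_action r "rep_op r d \<rho>"
proof
  fix a b c e and x y k
  assume ab: "a < r" "b < r"
  show "rep_op r d \<rho> a b (x + y) = rep_op r d \<rho> a b x + rep_op r d \<rho> a b y"
    by (simp add: rep_op_def mat_op_plus)
  show "rep_op r d \<rho> a b (cscale k x) = cscale k (rep_op r d \<rho> a b x)"
    by (simp add: rep_op_def mat_op_scale)
  assume ce: "c < r" "e < r"
  show "rep_op r d \<rho> a b (rep_op r d \<rho> c e x) = rep_op r d \<rho> c e (rep_op r d \<rho> a b x) +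
      (if b = c then rep_op r d \<rho> a e x else 0) - (if a = e then rep_op r d \<rho> c b x else 0)"
    unfolding rep_op_def rep_bracket[OF elem_mat_carrier elem_mat_carrier, of a b c e x]
    using ab ce by (auto simp: elem_mat_mult rep_zero)
qed

text \<open>A matrix is built up from matrix units one entry at a time. The formulation by a set of pairs
  makes this a finite induction.\<close>

lemma rep_expand:
  assumes X: "X \<in> carrier_mat r r"
  shows "mat_op d (\<rho> X) f = (\<Sum>(a, b)\<in>{..<r} \<times> {..<r}. cscale (X $$ (a, b)) (rep_op r d \<rho> a b f))"
proof -
  define XS where "XS = (\<lambda>S. mat r r (\<lambda>(i, j). if (i, j) \<in> S then X $$ (i, j) else 0))"
  have XSc: "XS S \<in> carrier_mat r r" for S by (simp add: XS_def)
  have partial: "mat_op d (\<rho> (XS S)) f = (\<Sum>(a, b)\<in>S. cscale (X $$ (a, b)) (rep_op r d \<rho> a b f))"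
    if "finite S" "S \<subseteq> {..<r} \<times> {..<r}" for S
    using that
  proof (induction S rule: finite_induct)
    case empty
    have "XS {} = 0\<^sub>m r r" by (intro eq_matI) (auto simp: XS_def)
    then show ?case by (simp add: rep_zero)
  next
    case (insert p S)
    obtain a b where p: "p = (a, b)" by (cases p)
    have "XS (insert p S) = X $$ (a, b) \<cdot>\<^sub>m elem_mat r a b + XS S"
      using insert.hyps by (intro eq_matI) (auto simp: XS_def elem_mat_def p)
    then have "mat_op d (\<rho> (XS (insert p S))) f = cscale (X $$ (a, b)) (rep_op r d \<rho> a b f) + mat_op d (\<rho> (XS S)) f"
      by (simp add: rep_add rep_smult XSc rep_op_def)
    then show ?case using insert by (simp add: p)
  qed
  moreover have "XS ({..<r} \<times> {..<r}) = X" using X by (intro eq_matI) (auto simp: XS_def)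
  ultimately show ?thesis using partial[of "{..<r} \<times> {..<r}"] by simp
qed

lemma weight_space_iff:
  assumes v: "v \<in> carrier_vec d"
  shows "v \<in> weight_space r d \<rho> \<omega> \<longleftrightarrow> weight_vector r (rep_op r d \<rho>) \<omega> (coords v)"
proof
  assume "v \<in> weight_space r d \<rho> \<omega>"
  then have w: "\<rho> (mat_diag r h) *\<^sub>v v = (\<Sum>i<r. h i * of_int (\<omega> i)) \<cdot>\<^sub>v v" for h
    by (simp add: weight_space_def)
  show "weight_vector r (rep_op r d \<rho>) \<omega> (coords v)" unfolding weight_vector_def
  proof (intro allI impI)
    fix a assume a: "a < r"
    let ?h = "\<lambda>i. if i = a then 1 else 0 :: complex"
    have "elem_mat r a a = mat_diag r ?h" by (auto simp: elem_mat_def mat_diag_def)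
    moreover have "(\<Sum>i<r. ?h i * of_int (\<omega> i)) = (of_int (\<omega> a) :: complex)"
      using a by (simp add: if_distrib[of "\<lambda>x. x * _"] cong: if_cong)
    ultimately show "rep_op r d \<rho> a a (coords v) = cscale (of_int (\<omega> a)) (coords v)"
      using w[of ?h] coords_mult[of "\<rho> (elem_mat r a a)" d v] v by (simp add: rep_op_def coords_smult)
  qed
next
  assume w: "weight_vector r (rep_op r d \<rho>) \<omega> (coords v)"
  have "\<rho> (mat_diag r h) *\<^sub>v v = (\<Sum>i<r. h i * of_int (\<omega> i)) \<cdot>\<^sub>v v" for h
  proof -
    have "coords (\<rho> (mat_diag r h) *\<^sub>v v) = (\<Sum>(a, b)\<in>{..<r} \<times> {..<r}. cscale (mat_diag r h $$ (a, b)) (rep_op r d \<rho> a b (coords v)))"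
      using v by (simp add: coords_mult[of _ d] rep_expand)
    also have "\<dots> = (\<Sum>a<r. \<Sum>b<r. cscale (mat_diag r h $$ (a, b)) (rep_op r d \<rho> a b (coords v)))"
      by (simp add: sum.cartesian_product)
    also have "\<dots> = (\<Sum>a<r. \<Sum>b<r. if b = a then cscale (h a * of_int (\<omega> a)) (coords v) else 0)"
      using w by (intro sum.cong refl) (auto simp: mat_diag_def weight_vector_def)
    also have "\<dots> = cscale (\<Sum>i<r. h i * of_int (\<omega> i)) (coords v)"
      by (simp add: cf.scale_sum_left)
    finally have "coords (\<rho> (mat_diag r h) *\<^sub>v v) = coords ((\<Sum>i<r. h i * of_int (\<omega> i)) \<cdot>\<^sub>v v)"
      by (simp add: coords_smult)
    then show ?thesis using v by (subst (asm) coords_eq_iff[of _ d]) (auto intro!: mult_mat_vec_carrier[of _ d d])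
  qed
  then show "v \<in> weight_space r d \<rho> \<omega>" using v by (simp add: weight_space_def)
qed

lemma coords_weight_space:
  "coords ` weight_space r d \<rho> \<omega> = {f \<in> supported d. weight_vector r (rep_op r d \<rho>) \<omega> f}"
proof (intro equalityI subsetI)
  fix f assume "f \<in> coords ` weight_space r d \<rho> \<omega>"
  then obtain v where v: "v \<in> weight_space r d \<rho> \<omega>" "f = coords v" by auto
  then have "v \<in> carrier_vec d" by (simp add: weight_space_def)
  then show "f \<in> {f \<in> supported d. weight_vector r (rep_op r d \<rho>) \<omega> f}"
    using v weight_space_iff by auto
next
  fix f assume "f \<in> {f \<in> supported d. weight_vector r (rep_op r d \<rho>) \<omega> f}"
  then show "f \<in> coords ` weight_space r d \<rho> \<omega>"
    using weight_space_iff[of "vec d f"] by (intro image_eqI[of _ _ "vec d f"]) auto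
qed

end

lemma vec_subspace_iff:
  "subspace class_ring W (module_vec TYPE(complex) d) \<longleftrightarrow>
     W \<subseteq> carrier_vec d \<and> 0\<^sub>v d \<in> W \<and> (\<forall>v\<in>W. \<forall>w\<in>W. v + w \<in> W) \<and> (\<forall>c. \<forall>v\<in>W. c \<cdot>\<^sub>v v \<in> W)"
  using vec_vs[where 'a = complex, of d] vec_module[where 'a = complex, of d]
  by (auto simp: subspace_def submodule_def module_vec_simps class_ring_simps)

lemma coords_subspace:
  assumes "subspace class_ring W (module_vec TYPE(complex) d)"
  shows "cf.subspace (coords ` W)"
proof (rule cf.subspaceI)
  have W: "W \<subseteq> carrier_vec d" "0\<^sub>v d \<in> W" "\<And>v w. v \<in> W \<Longrightarrow> w \<in> W \<Longrightarrow> v + w \<in> W"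
    "\<And>c v. v \<in> W \<Longrightarrow> c \<cdot>\<^sub>v v \<in> W" using assms by (auto simp: vec_subspace_iff)
  show "0 \<in> coords ` W" using W(2) by (intro image_eqI[of _ _ "0\<^sub>v d"]) auto
  show "x + y \<in> coords ` W" if "x \<in> coords ` W" "y \<in> coords ` W" for x y
  proof -
    from that obtain v w where "v \<in> W" "w \<in> W" "x = coords v" "y = coords w" by auto
    then show ?thesis using W by (intro image_eqI[of _ _ "v + w"]) (auto simp: coords_add[of v d w] subset_iff)
  qed
  show "cscale c x \<in> coords ` W" if x: "x \<in> coords ` W" for c x
  proof -
    from x obtain v where "v \<in> W" "x = coords v" by auto
    then show ?thesis using W by (intro image_eqI[of _ _ "c \<cdot>\<^sub>v v"]) (auto simp: coords_smult)
  qed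
qed

text \<open>The dimension of a space of vectors, in the sense of locales with carriers, is the number of
  elements of a basis of the corresponding space of functions.\<close>

lemma dim_eq_card_basis:
  assumes W: "subspace class_ring W (module_vec TYPE(complex) d)"
  obtains B where "finite B" "cf.independent B" "B \<subseteq> coords ` W" "coords ` W \<subseteq> cf.span B"
    "card B = vectorspace.dim class_ring ((module_vec TYPE(complex) d)\<lparr>carrier := W\<rparr>)"
proof -
  interpret V: vec_space "TYPE(complex)" d .
  have Wc: "W \<subseteq> carrier_vec d" using W by (simp add: vec_subspace_iff)
  obtain B where B: "B \<subseteq> coords ` W" "cf.independent B" "coords ` W \<subseteq> cf.span B"
    using cf.maximal_independent_subset[of "coords ` W"] by blast
  define A where "A = {v \<in> W. coords v \<in> B}"
  have AB: "coords ` A = B" using B(1) by (auto simp: A_def)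
  have AW: "A \<subseteq> W" by (auto simp: A_def)
  have Ac: "A \<subseteq> carrier_vec d" using AW Wc by auto
  have inj: "inj_on coords A" using inj_on_coords Ac by (rule inj_on_subset)
  have finB: "finite B"
  proof -
    have "B \<subseteq> cf.span (indicator_at ` {..<d})"
    proof
      fix f assume "f \<in> B"
      then obtain v where "v \<in> W" "f = coords v" using B(1) by auto
      then have f: "f \<in> supported d" using Wc by auto
      show "f \<in> cf.span (indicator_at ` {..<d})"
        by (rule finitely_supported_in_span) (use f in \<open>auto simp: supported_def not_le[symmetric]\<close>)
    qed
    then show ?thesis using cf.independent_span_bound[OF _ B(2)] by blast
  qed
  then have finA: "finite A" using AB inj finite_imageD by blast
  have coords_lincomb: "coords (V.lincomb a T) = (\<Sum>v\<in>T. cscale (a v) (coords v))"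
    if "T \<subseteq> carrier_vec d" "finite T" for a T
  proof -
    have "dim_vec (V.lincomb a T) = d" using that by (simp add: V.lincomb_dim)
    moreover have "V.lincomb a T $ i = (\<Sum>v\<in>T. a v * v $ i)" if "i < d" for i
      using V.lincomb_index[OF that \<open>T \<subseteq> carrier_vec d\<close>] .
    moreover have "dim_vec v = d" if "v \<in> T" for v using that \<open>T \<subseteq> carrier_vec d\<close> by auto
    ultimately show ?thesis by (auto simp: fun_eq_iff sum_apply pointwise coords_def intro!: sum.cong)
  qed
  have li: "\<not> V.lin_dep A"
  proof
    assume "V.lin_dep A"
    then obtain T a v where T: "finite T" "T \<subseteq> A" "V.lincomb a T = 0\<^sub>v d" "v \<in> T" "a v \<noteq> 0"
      by (auto simp: V.lin_dep_def)
    have injT: "inj_on coords T" using inj T(2) by (rule inj_on_subset)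
    have "(\<Sum>v\<in>T. cscale (a v) (coords v)) = 0"
      using coords_lincomb[of T a] T(1,2,3) Ac by auto
    then have "(\<Sum>f\<in>coords ` T. cscale (a (vec d f)) f) = 0"
      unfolding sum.reindex[OF injT] o_def using T(2) Ac by (auto cong: sum.cong simp: subset_iff)
    then have "a (vec d (coords v)) = 0"
      using cf.independentD[OF B(2), of "coords ` T" "\<lambda>f. a (vec d f)" "coords v"] T AB by auto
    then show False using T Ac by auto
  qed
  have span: "V.span A = W"
  proof
    have "V.span A \<subseteq> W" using V.span_is_subset[of A W] AW W by (auto simp: subspace_def)
    then show "V.span A \<subseteq> W" .
    show "W \<subseteq> V.span A"
    proof
      fix w assume w: "w \<in> W"
      then have "coords w \<in> cf.span (coords ` A)" using B(3) AB by auto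
      then obtain u where "coords w = (\<Sum>f\<in>coords ` A. cscale (u f) f)"
        using cf.span_finite[of "coords ` A"] finA by auto
      then have "coords w = (\<Sum>v\<in>A. cscale (u (coords v)) (coords v))"
        by (simp add: sum.reindex[OF inj])
      then have "coords w = coords (V.lincomb (\<lambda>v. u (coords v)) A)"
        by (simp add: coords_lincomb[OF Ac finA])
      moreover have "V.lincomb (\<lambda>v. u (coords v)) A \<in> carrier_vec d"
        using V.lincomb_dim[OF finA Ac] by (metis carrier_vec_dim_vec)
      ultimately have "w = V.lincomb (\<lambda>v. u (coords v)) A"
        using w Wc coords_eq_iff[of w d] by auto
      then show "w \<in> V.span A" using finA by (auto simp: V.span_def)
    qed
  qed
  have sub: "submodule class_ring W V.V" using W by (simp add: subspace_def)
  interpret VW: vectorspace class_ring "V.V\<lparr>carrier := W\<rparr>" by (rule V.subspace_is_vs[OF W])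
  have "VW.basis A"
    unfolding VW.basis_def using V.span_li_not_depend[OF AW sub] li span AW by auto
  then have "VW.dim = card A" by (rule VW.dim_basis[OF finA])
  then show ?thesis using that[OF finB B(2,1,3)] AB card_image[OF inj] by simp
qed

section \<open>Existence of the irreducible module\<close>

text \<open>The linear extension of \<open>E\<close> from matrix units to all matrices.\<close>

definition mat_act where
  "mat_act r E X x = (\<Sum>a<r. \<Sum>b<r. cscale (X $$ (a, b)) (E a b x))"

lemma mat_act_elem: "a < r \<Longrightarrow> b < r \<Longrightarrow> mat_act r E (elem_mat r a b) x = E a b x"
proof -
  assume ab: "a < r" "b < r"
  have "mat_act r E (elem_mat r a b) x = (\<Sum>i<r. \<Sum>j<r. if j = b then if i = a then E a b x else 0 else 0)"
    unfolding mat_act_def by (intro sum.cong refl) (auto simp: elem_mat_def)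
  then show ?thesis using ab by simp
qed

context gl_action
begin

lemma mat_act_plus: "mat_act r E X (x + y) = mat_act r E X x + mat_act r E X y"
proof -
  have "mat_act r E X (x + y) = (\<Sum>a<r. \<Sum>b<r. cscale (X $$ (a, b)) (E a b x) + cscale (X $$ (a, b)) (E a b y))"
    unfolding mat_act_def by (intro sum.cong refl) (simp add: add cf.scale_right_distrib)
  then show ?thesis by (simp add: mat_act_def sum.distrib)
qed

lemma mat_act_scale: "mat_act r E X (cscale c x) = cscale c (mat_act r E X x)"
proof -
  have "mat_act r E X (cscale c x) = (\<Sum>a<r. \<Sum>b<r. cscale c (cscale (X $$ (a, b)) (E a b x)))"
    unfolding mat_act_def by (intro sum.cong refl) (simp add: scale mult.commute)
  then show ?thesis by (simp add: mat_act_def cf.scale_sum_right)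
qed

lemma mat_act_zero: "mat_act r E X 0 = 0"
  using mat_act_scale[of X 0 0] by simp

lemma mat_act_sum: "mat_act r E X (\<Sum>i\<in>I. f i) = (\<Sum>i\<in>I. mat_act r E X (f i))"
  by (induction I rule: infinite_finite_induct) (simp_all add: mat_act_zero mat_act_plus)

lemma mat_act_add_mat:
  assumes "X \<in> carrier_mat r r" "Y \<in> carrier_mat r r"
  shows "mat_act r E (X + Y) x = mat_act r E X x + mat_act r E Y x"
proof -
  have "mat_act r E (X + Y) x = (\<Sum>a<r. \<Sum>b<r. cscale (X $$ (a, b)) (E a b x) + cscale (Y $$ (a, b)) (E a b x))"
    unfolding mat_act_def using assms by (intro sum.cong refl) (simp add: cf.scale_left_distrib)
  then show ?thesis by (simp add: mat_act_def sum.distrib)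
qed

lemma mat_act_smult_mat:
  assumes "X \<in> carrier_mat r r"
  shows "mat_act r E (c \<cdot>\<^sub>m X) x = cscale c (mat_act r E X x)"
proof -
  have "mat_act r E (c \<cdot>\<^sub>m X) x = (\<Sum>a<r. \<Sum>b<r. cscale c (cscale (X $$ (a, b)) (E a b x)))"
    unfolding mat_act_def using assms by (intro sum.cong refl) simp
  then show ?thesis by (simp add: mat_act_def cf.scale_sum_right)
qed

lemma mat_act_closed: "\<lbrakk>invariant r E W; x \<in> W\<rbrakk> \<Longrightarrow> mat_act r E X x \<in> W"
  unfolding mat_act_def invariant_def
  by (intro cf.subspace_sum cf.subspace_scale) auto

lemma mat_act_bracket:
  assumes X: "X \<in> carrier_mat r r" and Y: "Y \<in> carrier_mat r r"
  shows "mat_act r E (X * Y - Y * X) x =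
    mat_act r E X (mat_act r E Y x) - mat_act r E Y (mat_act r E X x)"
proof
  fix i
  let ?e = "\<lambda>a b. E a b x i"
  let ?n = "{..<r}"
  have ev: "mat_act r E Z x i = (\<Sum>a<r. \<Sum>b<r. Z $$ (a, b) * E a b x i)" for Z x
    by (simp add: mat_act_def sum_apply cscale_apply)
  have ev2: "mat_act r E Z (mat_act r E Z' x) i =
      (\<Sum>a<r. \<Sum>b<r. \<Sum>c<r. \<Sum>d<r. Z $$ (a, b) * Z' $$ (c, d) * E a b (E c d x) i)" for Z Z'
  proof -
    have "E a b (mat_act r E Z' x) i = (\<Sum>c<r. \<Sum>d<r. Z' $$ (c, d) * E a b (E c d x) i)"
      if "a < r" "b < r" for a b
      using that by (simp add: mat_act_def sum scale sum_apply cscale_apply)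
    then show ?thesis unfolding ev
      by (intro sum.cong refl) (simp add: sum_distrib_left mult.assoc)
  qed
  have prod: "(\<Sum>a<r. \<Sum>b<r. \<Sum>c<r. \<Sum>d<r. Z $$ (a, b) * Z' $$ (c, d) * (if b = c then ?e a d else 0)) =
      (\<Sum>a<r. \<Sum>d<r. (Z * Z') $$ (a, d) * ?e a d)" if "Z \<in> carrier_mat r r" "Z' \<in> carrier_mat r r" for Z Z'
  proof (rule sum.cong[OF refl])
    fix a assume a: "a \<in> ?n"
    have "(\<Sum>b<r. \<Sum>c<r. \<Sum>d<r. Z $$ (a, b) * Z' $$ (c, d) * (if b = c then ?e a d else 0)) =
        (\<Sum>b<r. \<Sum>c<r. if c = b then \<Sum>d<r. Z $$ (a, b) * Z' $$ (b, d) * ?e a d else 0)"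
      by (intro sum.cong refl) auto
    also have "\<dots> = (\<Sum>b<r. \<Sum>d<r. Z $$ (a, b) * Z' $$ (b, d) * ?e a d)" by simp
    also have "\<dots> = (\<Sum>d<r. \<Sum>b<r. Z $$ (a, b) * Z' $$ (b, d) * ?e a d)" by (rule sum.swap)
    also have "\<dots> = (\<Sum>d<r. (Z * Z') $$ (a, d) * ?e a d)"
      using that a by (intro sum.cong) (auto simp: scalar_prod_def atLeast0LessThan sum_distrib_right)
    finally show "(\<Sum>b<r. \<Sum>c<r. \<Sum>d<r. Z $$ (a, b) * Z' $$ (c, d) * (if b = c then ?e a d else 0)) =
      (\<Sum>d<r. (Z * Z') $$ (a, d) * ?e a d)" .
  qed
  have four_swap: "(\<Sum>a<r. \<Sum>b<r. \<Sum>c<r. \<Sum>d<r. F a b c d) = (\<Sum>c<r. \<Sum>d<r. \<Sum>a<r. \<Sum>b<r. F a b c d)"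
    for F :: "nat \<Rightarrow> nat \<Rightarrow> nat \<Rightarrow> nat \<Rightarrow> complex"
  proof -
    have three_swap: "(\<Sum>a<r. \<Sum>b<r. \<Sum>c<r. H a b c) = (\<Sum>c<r. \<Sum>a<r. \<Sum>b<r. H a b c)"
      for H :: "nat \<Rightarrow> nat \<Rightarrow> nat \<Rightarrow> complex"
    proof -
      have "(\<Sum>a<r. \<Sum>b<r. \<Sum>c<r. H a b c) = (\<Sum>a<r. \<Sum>c<r. \<Sum>b<r. H a b c)"
        by (rule sum.cong[OF refl], rule sum.swap)
      also have "\<dots> = (\<Sum>c<r. \<Sum>a<r. \<Sum>b<r. H a b c)" by (rule sum.swap)
      finally show ?thesis .
    qed
    have "(\<Sum>a<r. \<Sum>b<r. \<Sum>c<r. \<Sum>d<r. F a b c d) = (\<Sum>c<r. \<Sum>a<r. \<Sum>b<r. \<Sum>d<r. F a b c d)"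
      by (rule three_swap)
    also have "\<dots> = (\<Sum>c<r. \<Sum>d<r. \<Sum>a<r. \<Sum>b<r. F a b c d)"
      by (rule sum.cong[OF refl], rule three_swap)
    finally show ?thesis .
  qed
  have pointwise_bracket: "X $$ (a, b) * Y $$ (c, d) * E a b (E c d x) i =
      X $$ (a, b) * Y $$ (c, d) * E c d (E a b x) i
        + X $$ (a, b) * Y $$ (c, d) * (if b = c then ?e a d else 0)
        - Y $$ (c, d) * X $$ (a, b) * (if d = a then ?e c b else 0)"
    if "a < r" "b < r" "c < r" "d < r" for a b c d
    unfolding bracket[OF that, of x] by (auto simp: pointwise algebra_simps)
  have "mat_act r E X (mat_act r E Y x) i =
      (\<Sum>a<r. \<Sum>b<r. \<Sum>c<r. \<Sum>d<r. X $$ (a, b) * Y $$ (c, d) * E c d (E a b x) i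
        + X $$ (a, b) * Y $$ (c, d) * (if b = c then ?e a d else 0)
        - Y $$ (c, d) * X $$ (a, b) * (if d = a then ?e c b else 0))"
    unfolding ev2 by (intro sum.cong refl pointwise_bracket) simp_all
  also have "\<dots> = (\<Sum>a<r. \<Sum>b<r. \<Sum>c<r. \<Sum>d<r. X $$ (a, b) * Y $$ (c, d) * E c d (E a b x) i)
      + (\<Sum>a<r. \<Sum>b<r. \<Sum>c<r. \<Sum>d<r. X $$ (a, b) * Y $$ (c, d) * (if b = c then ?e a d else 0))
      - (\<Sum>a<r. \<Sum>b<r. \<Sum>c<r. \<Sum>d<r. Y $$ (c, d) * X $$ (a, b) * (if d = a then ?e c b else 0))"
    by (simp only: sum.distrib sum_subtractf)
  also have "(\<Sum>a<r. \<Sum>b<r. \<Sum>c<r. \<Sum>d<r. X $$ (a, b) * Y $$ (c, d) * E c d (E a b x) i) =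
      mat_act r E Y (mat_act r E X x) i"
    unfolding ev2 by (subst four_swap) (intro sum.cong refl, simp)
  also have "(\<Sum>a<r. \<Sum>b<r. \<Sum>c<r. \<Sum>d<r. X $$ (a, b) * Y $$ (c, d) * (if b = c then ?e a d else 0)) =
      (\<Sum>a<r. \<Sum>d<r. (X * Y) $$ (a, d) * ?e a d)" by (rule prod[OF X Y])
  also have "(\<Sum>a<r. \<Sum>b<r. \<Sum>c<r. \<Sum>d<r. Y $$ (c, d) * X $$ (a, b) * (if d = a then ?e c b else 0)) =
      (\<Sum>a<r. \<Sum>d<r. (Y * X) $$ (a, d) * ?e a d)"
    unfolding prod[OF Y X, symmetric] by (subst four_swap) (rule refl)
  finally have "mat_act r E X (mat_act r E Y x) i - mat_act r E Y (mat_act r E X x) i =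
      (\<Sum>a<r. \<Sum>d<r. (X * Y) $$ (a, d) * ?e a d) - (\<Sum>a<r. \<Sum>d<r. (Y * X) $$ (a, d) * ?e a d)" by simp
  also have "\<dots> = (\<Sum>a<r. \<Sum>d<r. (X * Y - Y * X) $$ (a, d) * ?e a d)"
    unfolding sum_subtractf[symmetric] using X Y by (intro sum.cong refl) (simp add: algebra_simps)
  finally show "mat_act r E (X * Y - Y * X) x i =
      (mat_act r E X (mat_act r E Y x) - mat_act r E Y (mat_act r E X x)) i"
    by (simp only: minus_apply ev[of "X * Y - Y * X" x])
qed

lemma mat_act_diag:
  assumes "weight_vector r E \<omega> x"
  shows "mat_act r E (mat_diag r h) x = cscale (\<Sum>i<r. h i * of_int (\<omega> i)) x"
proof -
  have "mat_act r E (mat_diag r h) x = (\<Sum>a<r. \<Sum>b<r. if b = a then cscale (h a * of_int (\<omega> a)) x else 0)"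
    unfolding mat_act_def
  proof (intro sum.cong refl)
    fix a b assume "a \<in> {..<r}" "b \<in> {..<r}"
    then have ab: "a < r" "b < r" by simp_all
    have "E a a x = cscale (of_int (\<omega> a)) x"
      using assms ab(1) unfolding weight_vector_def by blast
    with ab show "cscale (mat_diag r h $$ (a, b)) (E a b x) =
        (if b = a then cscale (h a * of_int (\<omega> a)) x else 0)"
      by (cases "b = a") (simp_all add: mat_diag_def)
  qed
  then show ?thesis by (simp add: cf.scale_sum_left)
qed

lemma mat_act_strictly_upper:
  assumes "hw_vector r E lam v" "\<forall>i<r. \<forall>j\<le>i. X $$ (i, j) = 0"
  shows "mat_act r E X v = 0"
  unfolding mat_act_def
proof (intro sum.neutral ballI)
  fix a b assume "a \<in> {..<r}" "b \<in> {..<r}"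
  then show "cscale (X $$ (a, b)) (E a b v) = 0"
    using assms by (cases "b \<le> a") (auto simp: hw_vector_def)
qed

text \<open>By Zorn's lemma: not containing \<open>v\<close> is inherited by unions of chains.\<close>

lemma maximal_proper_invariant:
  assumes M: "invariant r E M" "v \<noteq> 0"
  obtains N where "invariant r E N" "N \<subseteq> M" "v \<notin> N"
    "\<And>N'. \<lbrakk>invariant r E N'; N \<subseteq> N'; N' \<subseteq> M; v \<notin> N'\<rbrakk> \<Longrightarrow> N' = N"
proof -
  define A where "A = {N. invariant r E N \<and> N \<subseteq> M \<and> v \<notin> N}"
  have "{0} \<in> A"
    using assms cf.subspace_0[of M] by (simp add: A_def invariant_def zero)
  moreover have "\<Union>C \<in> A" if C: "C \<noteq> {}" "subset.chain A C" for C
  proof -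
    have CA: "invariant r E N" "N \<subseteq> M" "v \<notin> N" "cf.subspace N" if "N \<in> C" for N
      using C(2) that by (auto simp: subset_chain_def A_def invariant_def)
    have "cf.subspace (\<Union>C)"
    proof (rule cf.subspaceI)
      obtain N where "N \<in> C" using C(1) by blast
      then show "0 \<in> \<Union>C" using cf.subspace_0[OF CA(4)] by blast
      show "cscale c x \<in> \<Union>C" if "x \<in> \<Union>C" for c x
        using that cf.subspace_scale[OF CA(4)] by blast
      show "x + y \<in> \<Union>C" if xy: "x \<in> \<Union>C" "y \<in> \<Union>C" for x y
      proof -
        obtain N1 N2 where N: "N1 \<in> C" "x \<in> N1" "N2 \<in> C" "y \<in> N2" using xy by auto
        then have "N1 \<subseteq> N2 \<or> N2 \<subseteq> N1" using C(2) by (auto simp: subset_chain_def)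
        then obtain N' where "N' \<in> C" "x \<in> N'" "y \<in> N'" using N by auto
        then show ?thesis using cf.subspace_add[OF CA(4)] by blast
      qed
    qed
    moreover have "E a b x \<in> \<Union>C" if "a < r" "b < r" "x \<in> \<Union>C" for a b x
      using that CA(1) unfolding invariant_def by blast
    ultimately have "invariant r E (\<Union>C)" unfolding invariant_def by blast
    moreover have "\<Union>C \<subseteq> M" "v \<notin> \<Union>C" using CA(2,3) by blast+
    ultimately show ?thesis by (simp add: A_def)
  qed
  ultimately obtain N where "N \<in> A" "\<And>N'. N' \<in> A \<Longrightarrow> N \<subseteq> N' \<Longrightarrow> N' = N"
    using subset_Zorn_nonempty[of A] by blast
  then show ?thesis using that[of N] by (auto simp: A_def)
qed

text \<open>Divide the module \<open>M\<close> generated by \<open>v\<close> by a submodule \<open>N\<close> that is maximal among those without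
  \<open>v\<close>. A submodule of \<open>M\<close> strictly larger than \<open>N\<close> contains \<open>v\<close> and is therefore \<open>M\<close>, so the
  quotient is irreducible. Its matrices are taken with respect to the basis given by the vectors
  that complete a basis of \<open>N\<close> to one of \<open>M\<close>.\<close>

lemma irreducible_quotient:
  assumes v: "hw_vector r E lam v" and F: "finite F" "cyclic r E lam v \<subseteq> cf.span F"
  shows "\<exists>d \<rho>. irreducible_gl_rep r d \<rho> \<and> has_highest_weight r d \<rho> lam"
proof -
  define M where "M = cyclic r E lam v"
  have Minv: "invariant r E M" unfolding M_def by (rule cyclic_invariant[OF v])
  have vM: "v \<in> M" unfolding M_def cyclic_def by (rule cf.span_base) (auto intro: descends.top)
  have generate: "M \<subseteq> N'" if N': "invariant r E N'" "v \<in> N'" for N'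
  proof -
    have "descends r E lam v \<omega> x \<Longrightarrow> x \<in> N'" for \<omega> x
      by (induction rule: descends.induct) (use N' in \<open>auto simp: invariant_def\<close>)
    then show ?thesis unfolding M_def cyclic_def
      by (intro cf.span_minimal) (use N' in \<open>auto simp: invariant_def\<close>)
  qed
  obtain N where N: "invariant r E N" "N \<subseteq> M" "v \<notin> N"
    and Nmax: "\<And>N'. \<lbrakk>invariant r E N'; N \<subseteq> N'; N' \<subseteq> M; v \<notin> N'\<rbrakk> \<Longrightarrow> N' = N"
    using maximal_proper_invariant[OF Minv] v by (auto simp: hw_vector_def)
  have Msub: "cf.subspace M" and Nsub: "cf.subspace N" using Minv N by (auto simp: invariant_def)
  obtain BN where BN: "BN \<subseteq> N" "cf.independent BN" "N \<subseteq> cf.span BN"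
    using cf.maximal_independent_subset[of N] by blast
  obtain BM where BM: "BN \<subseteq> BM" "BM \<subseteq> M" "cf.independent BM" "M \<subseteq> cf.span BM"
    using cf.maximal_independent_subset_extend[of BN M] BN N by blast
  have "finite BM"
    using cf.independent_span_bound[OF F(1) BM(3)] BM(2) F(2) by (auto simp: M_def)
  have spM: "cf.span BM = M" using BM Msub cf.span_minimal by blast
  have spN: "cf.span BN = N" using BN Nsub cf.span_minimal by blast
  define d where "d = card (BM - BN)"
  obtain b where b: "bij_betw b {..<d} (BM - BN)"
    using ex_bij_betw_nat_finite[of "BM - BN"] \<open>finite BM\<close> by (auto simp: d_def atLeast0LessThan)
  have bBM: "b i \<in> BM" "b i \<notin> BN" if "i < d" for i using b that by (auto simp: bij_betw_def)
  have bM: "b i \<in> M" if "i < d" for i using bBM that BM(2) by blast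
  \<comment> \<open>\<open>k\<close> is the projection to the quotient, in coordinates: a linear map from \<open>M\<close> onto
    \<open>supported d\<close> with kernel \<open>N\<close>.\<close>
  define k where "k = (\<lambda>x i. if i < d then cf.representation BM x (b i) else 0)"
  have k_supp: "k x \<in> supported d" for x by (simp add: k_def supported_def)
  have k_add: "k (x + y) = k x + k y" if "x \<in> M" "y \<in> M" for x y
  proof -
    have "x \<in> cf.span BM" "y \<in> cf.span BM" using that spM by simp_all
    from cf.representation_add[OF BM(3) this(2,1)] show ?thesis
      by (intro ext) (simp add: k_def plus_fun_apply)
  qed
  have k_scale: "k (cscale c x) = cscale c (k x)" if "x \<in> M" for c x
  proof -
    have "x \<in> cf.span BM" using that spM by simp
    from cf.representation_scale[OF BM(3) this, of c] show ?thesis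
      by (intro ext) (simp add: k_def cscale_apply)
  qed
  have k_zero: "k 0 = 0" using k_scale[of 0 0] cf.subspace_0[OF Msub] by simp
  have k_sum: "k (\<Sum>i\<in>I. f i) = (\<Sum>i\<in>I. k (f i))" if "\<And>i. i \<in> I \<Longrightarrow> f i \<in> M" for I and f :: "nat \<Rightarrow> _"
    using that
  proof (induction I rule: infinite_finite_induct)
    case (insert i I)
    have "sum f I \<in> M" by (rule cf.subspace_sum[OF Msub], rule insert.prems, rule insertI2)
    moreover have "f i \<in> M" by (rule insert.prems, rule insertI1)
    ultimately have "k (f i + sum f I) = k (f i) + k (sum f I)" by (intro k_add)
    moreover have "k (sum f I) = (\<Sum>i\<in>I. k (f i))"
      by (rule insert.IH, rule insert.prems, rule insertI2)
    ultimately show ?case using insert.hyps by simp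
  qed (simp_all add: k_zero)
  have k_N: "k x = 0" if "x \<in> N" for x
  proof
    fix i
    have "cf.representation BM x = cf.representation BN x"
      by (rule cf.representation_extend[OF BM(3) _ BM(1)]) (use that spN in simp)
    then show "k x i = 0 i"
      using bBM(2)[of i] cf.representation_ne_zero[of BN x "b i"] by (auto simp: k_def pointwise)
  qed
  have k_rest: "x - (\<Sum>i<d. cscale (k x i) (b i)) \<in> N" if x: "x \<in> M" for x
  proof -
    let ?R = "\<lambda>y. cscale (cf.representation BM x y) y"
    have "x = (\<Sum>y\<in>BM. ?R y)"
      using cf.sum_representation_eq[OF BM(3) _ \<open>finite BM\<close>, of x] x spM by simp
    also have "\<dots> = (\<Sum>y\<in>BM - BN. ?R y) + (\<Sum>y\<in>BN. ?R y)"
      using sum.subset_diff[OF BM(1) \<open>finite BM\<close>] by blast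
    also have "(\<Sum>y\<in>BM - BN. ?R y) = (\<Sum>i<d. cscale (k x i) (b i))"
      unfolding sum.reindex_bij_betw[OF b, symmetric] by (intro sum.cong) (auto simp: k_def)
    finally have "x = (\<Sum>i<d. cscale (k x i) (b i)) + (\<Sum>y\<in>BN. ?R y)" .
    then have "x - (\<Sum>i<d. cscale (k x i) (b i)) = (\<Sum>y\<in>BN. ?R y)"
      unfolding diff_eq_eq by (subst add.commute)
    also have "\<dots> \<in> N" using BN(1) by (intro cf.subspace_sum[OF Nsub] cf.subspace_scale[OF Nsub]) auto
    finally show ?thesis .
  qed
  have k_b: "k (b j) i = (if i = j then 1 else 0)" if "i < d" "j < d" for i j
  proof -
    have "b j = b i \<longleftrightarrow> j = i" using b that by (auto simp: bij_betw_def inj_on_def)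
    then show ?thesis using cf.representation_basis[OF BM(3) bBM(1)[OF that(2)]] that by (auto simp: k_def)
  qed
  have surj: "\<exists>x\<in>M. k x = f" if f: "f \<in> supported d" for f
  proof
    let ?x = "\<Sum>j<d. cscale (f j) (b j)"
    show "?x \<in> M" using bM by (intro cf.subspace_sum[OF Msub] cf.subspace_scale[OF Msub]) auto
    show "k ?x = f"
    proof
      fix i
      have "k ?x = (\<Sum>j<d. k (cscale (f j) (b j)))"
        using bM by (intro k_sum cf.subspace_scale[OF Msub]) auto
      also have "\<dots> = (\<Sum>j<d. cscale (f j) (k (b j)))" using bM k_scale by (intro sum.cong) auto
      finally have eq: "k ?x i = (\<Sum>j<d. f j * k (b j) i)" by (simp add: sum_apply cscale_apply)
      show "k ?x i = f i"
      proof (cases "i < d")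
        case True
        then have "(\<Sum>j<d. f j * k (b j) i) = (\<Sum>j<d. if j = i then f i else 0)"
          using k_b by (intro sum.cong) auto
        then show ?thesis using True eq by simp
      next
        case False
        then show ?thesis using f k_supp[of ?x] by (simp add: supported_def)
      qed
    qed
  qed
  define \<rho> where "\<rho> = (\<lambda>X. mat d d (\<lambda>(i, j). k (mat_act r E X (b j)) i))"
  have \<rho>_carrier: "\<rho> X \<in> carrier_mat d d" for X by (simp add: \<rho>_def)
  have act_M: "mat_act r E X x \<in> M" if "x \<in> M" for X x using mat_act_closed[OF Minv that] .
  \<comment> \<open>The matrix \<open>\<rho> X\<close> describes the action of \<open>X\<close> on the quotient.\<close>
  have key: "mat_op d (\<rho> X) (k x) = k (mat_act r E X x)" if x: "x \<in> M" for X x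
  proof -
    let ?n = "x - (\<Sum>j<d. cscale (k x j) (b j))"
    have bs: "(\<Sum>j<d. cscale (k x j) (mat_act r E X (b j))) \<in> M"
      using bM act_M by (intro cf.subspace_sum[OF Msub] cf.subspace_scale[OF Msub]) auto
    have nN: "mat_act r E X ?n \<in> N" using mat_act_closed[OF N(1) k_rest[OF x]] .
    have "mat_act r E X x = mat_act r E X ((\<Sum>j<d. cscale (k x j) (b j)) + ?n)" by simp
    also have "\<dots> = (\<Sum>j<d. cscale (k x j) (mat_act r E X (b j))) + mat_act r E X ?n"
      unfolding mat_act_plus mat_act_sum mat_act_scale ..
    finally have "k (mat_act r E X x) = k (\<Sum>j<d. cscale (k x j) (mat_act r E X (b j))) + k (mat_act r E X ?n)"
      using k_add[OF bs, of "mat_act r E X ?n"] nN N(2) by auto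
    also have "k (mat_act r E X ?n) = 0" using k_N nN by simp
    also have "k (\<Sum>j<d. cscale (k x j) (mat_act r E X (b j))) = (\<Sum>j<d. k (cscale (k x j) (mat_act r E X (b j))))"
      using bM act_M by (intro k_sum cf.subspace_scale[OF Msub]) auto
    also have "\<dots> = (\<Sum>j<d. cscale (k x j) (k (mat_act r E X (b j))))"
      using bM act_M k_scale by (intro sum.cong) auto
    finally have e: "k (mat_act r E X x) = (\<Sum>j<d. cscale (k x j) (k (mat_act r E X (b j))))" by simp
    show ?thesis
    proof
      fix i show "mat_op d (\<rho> X) (k x) i = k (mat_act r E X x) i"
      proof (cases "i < d")
        case True
        then show ?thesis unfolding e
          by (simp add: mat_op_def \<rho>_def sum_apply cscale_apply mult.commute)
      next
        case False
        then show ?thesis by (simp add: mat_op_def k_def)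
      qed
    qed
  qed
  have rep: "gl_rep r d \<rho>" unfolding gl_rep_def
  proof (intro conjI ballI allI)
    fix X Y :: "complex mat" and c assume X: "X \<in> carrier_mat r r"
    show "\<rho> X \<in> carrier_mat d d" by (rule \<rho>_carrier)
    show "\<rho> (c \<cdot>\<^sub>m X) = c \<cdot>\<^sub>m \<rho> X"
      by (rule eq_matI) (auto simp: \<rho>_def mat_act_smult_mat[OF X] k_scale act_M bM cscale_apply)
    assume Y: "Y \<in> carrier_mat r r"
    show "\<rho> (X + Y) = \<rho> X + \<rho> Y"
      by (rule eq_matI) (auto simp: \<rho>_def mat_act_add_mat[OF X Y] k_add act_M bM plus_fun_apply)
    have mult: "(\<rho> X * \<rho> Y) $$ (i, j) = k (mat_act r E X (mat_act r E Y (b j))) i"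
      if "i < d" "j < d" for i j and X Y :: "complex mat"
    proof -
      have "(\<rho> X * \<rho> Y) $$ (i, j) = mat_op d (\<rho> X) (k (mat_act r E Y (b j))) i"
        using that by (simp add: mat_op_def \<rho>_def scalar_prod_def atLeast0LessThan)
      then show ?thesis using key[OF act_M[OF bM[OF that(2)]]] by simp
    qed
    show "\<rho> (X * Y - Y * X) = \<rho> X * \<rho> Y - \<rho> Y * \<rho> X"
    proof (rule eq_matI)
      fix i j assume "i < dim_row (\<rho> X * \<rho> Y - \<rho> Y * \<rho> X)" "j < dim_col (\<rho> X * \<rho> Y - \<rho> Y * \<rho> X)"
      then have ij: "i < d" "j < d" by (auto simp: \<rho>_def)
      have k_diff: "k (x - y) = k x - k y" if "x \<in> M" "y \<in> M" for x y
        using k_add[of "x - y" y] cf.subspace_diff[OF Msub that] that by (simp add: algebra_simps)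
      have "\<rho> (X * Y - Y * X) $$ (i, j) =
          k (mat_act r E X (mat_act r E Y (b j)) - mat_act r E Y (mat_act r E X (b j))) i"
        using ij by (simp add: \<rho>_def mat_act_bracket[OF X Y])
      also have "\<dots> = (\<rho> X * \<rho> Y) $$ (i, j) - (\<rho> Y * \<rho> X) $$ (i, j)"
        using ij by (simp add: k_diff act_M bM mult minus_apply)
      also have "\<dots> = (\<rho> X * \<rho> Y - \<rho> Y * \<rho> X) $$ (i, j)"
        using ij \<rho>_carrier[of X] \<rho>_carrier[of Y] by simp
      finally show "\<rho> (X * Y - Y * X) $$ (i, j) = (\<rho> X * \<rho> Y - \<rho> Y * \<rho> X) $$ (i, j)" .
    qed (auto simp: \<rho>_def)
  qed
  have kv: "k v \<noteq> 0"
  proof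
    assume "k v = 0"
    then have "v \<in> N" using k_rest[OF vM] by (simp add: zero_fun_apply)
    then show False using N(3) by simp
  qed
  have "d > 0"
  proof (rule ccontr)
    assume "\<not> d > 0"
    then have "k v = 0" by (auto simp: k_def fun_eq_iff pointwise)
    then show False using kv by simp
  qed
  have rep_vec: "\<rho> X *\<^sub>v vec d (k x) = vec d (k (mat_act r E X x))" if "x \<in> M" for X x
  proof -
    have "coords (\<rho> X *\<^sub>v vec d (k x)) = coords (vec d (k (mat_act r E X x)))"
      using key[OF that] k_supp \<rho>_carrier by (simp add: coords_mult[of _ d])
    then show ?thesis using \<rho>_carrier[of X]
      by (subst (asm) coords_eq_iff[of _ d]) (auto intro!: mult_mat_vec_carrier[of _ d d])
  qed
  have irr: "W = {0\<^sub>v d} \<or> W = carrier_vec d"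
    if W: "subspace class_ring W (module_vec TYPE(complex) d)"
      "\<forall>X\<in>carrier_mat r r. \<forall>w\<in>W. \<rho> X *\<^sub>v w \<in> W" for W
  proof (cases "W = {0\<^sub>v d}")
    case False
    have Wp: "W \<subseteq> carrier_vec d" "0\<^sub>v d \<in> W" using W(1) by (auto simp: vec_subspace_iff)
    \<comment> \<open>The preimage of \<open>W\<close> in \<open>M\<close> is strictly larger than \<open>N\<close>.\<close>
    define N' where "N' = {x \<in> M. k x \<in> coords ` W}"
    have Wsub: "cf.subspace (coords ` W)" by (rule coords_subspace[OF W(1)])
    have N'inv: "invariant r E N'" unfolding invariant_def
    proof (intro conjI allI impI ballI)
      show "cf.subspace N'"
        using Msub Wsub by (auto simp: N'_def cf.subspace_def k_add k_scale k_zero)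
      fix a b' x assume ab: "a < r" "b' < r" and x: "x \<in> N'"
      then obtain w where w: "w \<in> W" "k x = coords w" by (auto simp: N'_def)
      have "E a b' x \<in> M" using ab x Minv by (auto simp: N'_def invariant_def)
      moreover have "k (E a b' x) = coords (\<rho> (elem_mat r a b') *\<^sub>v w)"
        using key[of x "elem_mat r a b'"] x w Wp ab \<rho>_carrier
        by (simp add: N'_def mat_act_elem coords_mult[of _ d] subset_iff)
      ultimately show "E a b' x \<in> N'" using W(2) w by (auto simp: N'_def)
    qed
    have "N \<subseteq> N'" using N(2) k_N Wp(2) by (auto simp: N'_def intro!: image_eqI[of _ _ "0\<^sub>v d"])
    obtain w where w: "w \<in> W" "w \<noteq> 0\<^sub>v d" using False Wp(2) by auto
    then have "coords w \<noteq> 0" using coords_eq_iff[of w d "0\<^sub>v d"] Wp by auto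
    moreover have "coords w \<in> supported d" using w Wp by (simp add: subset_iff)
    then obtain x where x: "x \<in> M" "k x = coords w" using surj by blast
    ultimately have "x \<notin> N" "x \<in> N'" using k_N w by (auto simp: N'_def)
    then have "N' \<noteq> N" by auto
    then have "v \<in> N'" using Nmax[OF N'inv \<open>N \<subseteq> N'\<close>] by (auto simp: N'_def)
    then have "M \<subseteq> N'" using generate[OF N'inv] by simp
    have "carrier_vec d \<subseteq> W"
    proof
      fix u :: "complex vec" assume u: "u \<in> carrier_vec d"
      obtain y where y: "y \<in> M" "k y = coords u" using surj[of "coords u"] u by auto
      then obtain w' where "w' \<in> W" "coords u = coords w'" using \<open>M \<subseteq> N'\<close> by (auto simp: N'_def)
      then show "u \<in> W" using u Wp coords_eq_iff[of u d w'] by auto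
    qed
    then show ?thesis using Wp by auto
  qed simp
  have "irreducible_gl_rep r d \<rho>"
    unfolding irreducible_gl_rep_def using rep \<open>d > 0\<close> irr by blast
  moreover have "has_highest_weight r d \<rho> lam" unfolding has_highest_weight_def
  proof (intro bexI conjI ballI impI)
    show "vec d (k v) \<noteq> 0\<^sub>v d"
    proof
      assume "vec d (k v) = 0\<^sub>v d"
      then have "coords (vec d (k v)) = 0" by simp
      then show False using kv k_supp by simp
    qed
    show "vec d (k v) \<in> weight_space r d \<rho> lam"
    proof -
      have "\<rho> (mat_diag r h) *\<^sub>v vec d (k v) = (\<Sum>i<r. h i * of_int (lam i)) \<cdot>\<^sub>v vec d (k v)" for h
        using rep_vec[OF vM, of "mat_diag r h"] mat_act_diag[of lam v h] v k_scale[OF vM]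
        by (auto simp: hw_vector_def cscale_apply intro!: eq_vecI)
      then show ?thesis by (simp add: weight_space_def)
    qed
    fix X :: "complex mat" assume "\<forall>i<r. \<forall>j\<le>i. X $$ (i, j) = 0"
    then show "\<rho> X *\<^sub>v vec d (k v) = 0\<^sub>v d"
      using rep_vec[OF vM, of X] mat_act_strictly_upper[OF v, of X] k_zero
      by (auto simp: zero_fun_apply intro!: eq_vecI)
  qed
  ultimately show ?thesis by blast
qed

end

section \<open>Weights and multiplicities of the irreducible module\<close>

lemma gl_action_restrict:
  assumes "gl_action r E" "r' \<le> r"
  shows "gl_action r' E"
proof -
  interpret gl_action r E by fact
  show ?thesis
  proof
    fix a b c d x y k
    assume "a < r'" "b < r'"
    then have ab: "a < r" "b < r" using assms(2) by simp_all
    show "E a b (x + y) = E a b x + E a b y" by (rule add[OF ab])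
    show "E a b (cscale k x) = cscale k (E a b x)" by (rule scale[OF ab])
    assume "c < r'" "d < r'"
    then have cd: "c < r" "d < r" using assms(2) by simp_all
    show "E a b (E c d x) =
        E c d (E a b x) + (if b = c then E a d x else 0) - (if a = d then E c b x else 0)"
      by (rule bracket[OF ab cd])
  qed
qed

lemma hw_vector_restrict: "hw_vector r E lam v \<Longrightarrow> r' \<le> r \<Longrightarrow> hw_vector r' E lam v"
  by (auto simp: hw_vector_def weight_vector_def)

lemma (in gl_representation) hw_vector_coords:
  assumes "has_highest_weight r d \<rho> lam"
  obtains v where "v \<in> supported d" "hw_vector r (rep_op r d \<rho>) lam v"
proof -
  obtain v where v: "v \<in> weight_space r d \<rho> lam" "v \<noteq> 0\<^sub>v d"
    "\<And>X. \<lbrakk>X \<in> carrier_mat r r; \<forall>i<r. \<forall>j\<le>i. X $$ (i, j) = 0\<rbrakk> \<Longrightarrow> \<rho> X *\<^sub>v v = 0\<^sub>v d"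
    using assms by (auto simp: has_highest_weight_def)
  have vc: "v \<in> carrier_vec d" using v(1) by (simp add: weight_space_def)
  have "coords v \<noteq> 0" using coords_eq_iff[of v d "0\<^sub>v d"] vc v(2) by auto
  moreover have "rep_op r d \<rho> a b (coords v) = 0" if "a < b" "b < r" for a b
  proof -
    have "\<rho> (elem_mat r a b) *\<^sub>v v = 0\<^sub>v d"
      using that by (intro v(3)) (auto simp: elem_mat_def)
    then show ?thesis using coords_mult[of "\<rho> (elem_mat r a b)" d v] vc by (simp add: rep_op_def)
  qed
  ultimately have "hw_vector r (rep_op r d \<rho>) lam (coords v)"
    using weight_space_iff[OF vc] v(1) by (auto simp: hw_vector_def)
  then show ?thesis using that[of "coords v"] vc by simp
qed

lemma (in gl_representation) irreducible_invariant:
  assumes irr: "irreducible_gl_rep r d \<rho>"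
    and W: "invariant r (rep_op r d \<rho>) W" "W \<subseteq> supported d"
  shows "W = {0} \<or> W = supported d"
proof -
  have Ws: "cf.subspace W" using W by (simp add: invariant_def)
  define U where "U = {v \<in> carrier_vec d. coords v \<in> W}"
  have UW: "coords ` U = W"
  proof (intro equalityI subsetI)
    fix f assume "f \<in> W"
    then show "f \<in> coords ` U" using W(2)
      by (intro image_eqI[of _ _ "vec d f"]) (auto simp: U_def subset_iff)
  qed (auto simp: U_def)
  have "subspace class_ring U (module_vec TYPE(complex) d)"
    unfolding vec_subspace_iff
    using cf.subspace_0[OF Ws] cf.subspace_add[OF Ws] cf.subspace_scale[OF Ws]
    by (auto simp: U_def coords_add[of _ d] coords_smult)
  moreover have "\<rho> X *\<^sub>v w \<in> U" if X: "X \<in> carrier_mat r r" and w: "w \<in> U" for X w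
  proof -
    have wc: "w \<in> carrier_vec d" using w by (simp add: U_def)
    have "coords (\<rho> X *\<^sub>v w) = (\<Sum>(a, b)\<in>{..<r} \<times> {..<r}. cscale (X $$ (a, b)) (rep_op r d \<rho> a b (coords w)))"
      using X wc by (simp add: coords_mult[of _ d] rep_expand)
    also have "\<dots> \<in> W" using W(1) w
      by (intro cf.subspace_sum[OF Ws]) (auto simp: invariant_def U_def intro!: cf.subspace_scale[OF Ws])
    finally show ?thesis using X wc by (auto simp: U_def intro!: mult_mat_vec_carrier[of _ d d])
  qed
  ultimately have "U = {0\<^sub>v d} \<or> U = carrier_vec d"
    using irr by (auto simp: irreducible_gl_rep_def)
  then show ?thesis
  proof
    assume "U = {0\<^sub>v d}"
    then show ?thesis using UW by auto
  next
    assume "U = carrier_vec d"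
    then have "supported d \<subseteq> W" using UW
      by (metis coords_vec image_eqI subsetI vec_carrier)
    then show ?thesis using W(2) by auto
  qed
qed

lemma (in gl_representation) supported_invariant: "invariant r (rep_op r d \<rho>) (supported d)"
  unfolding invariant_def by (simp add: subspace_supported rep_op_def)

lemma (in gl_representation) weight_space_subspace:
  "subspace class_ring (weight_space r d \<rho> \<omega>) (module_vec TYPE(complex) d)"
proof -
  let ?w = "weight_vector r (rep_op r d \<rho>) \<omega>"
  have sub: "cf.subspace {x. ?w x}" by (rule subspace_weight)
  have c: "weight_space r d \<rho> \<omega> = {v \<in> carrier_vec d. ?w (coords v)}"
    using weight_space_iff by (auto simp: weight_space_def)
  show ?thesis unfolding vec_subspace_iff c
    using cf.subspace_0[OF sub] cf.subspace_add[OF sub] cf.subspace_scale[OF sub]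
    by (auto simp: coords_add[of _ d] coords_smult)
qed

text \<open>Diagonal matrix units count letters.\<close>

lemma word_hw_weight:
  assumes "\<And>w. g w \<noteq> 0 \<Longrightarrow> word_weight w = lam"
  shows "weight_vector r word_op lam g"
  unfolding weight_vector_def
proof (intro allI impI ext)
  fix a :: nat and w :: "nat list"
  have cnt: "(\<Sum>p<length w. if w ! p = a then c else 0) = of_nat (count_list w a) * (c :: complex)" for c
  proof (induction w)
    case (Cons x w)
    then show ?case by (simp add: lessThan_Suc_eq_insert_0 sum.reindex algebra_simps del: sum.lessThan_Suc)
  qed simp
  have "word_op a a g w = (\<Sum>p<length w. if w ! p = a then g w else 0)"
    unfolding word_op_def by (intro sum.cong) auto
  also have "\<dots> = of_int (word_weight w a) * g w" by (simp add: cnt word_weight_def)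
  finally show "word_op a a g w = cscale (of_int (lam a)) g w"
    using assms[of w] by (cases "g w = 0") (auto simp: cscale_apply)
qed

lemma word_highest_weight_vector:
  assumes "is_partition lam"
  obtains g where "\<And>w. g w \<noteq> 0 \<Longrightarrow> word_weight w = (\<lambda>i. int (lam i))"
    "hw_vector r word_op (\<lambda>i. int (lam i)) g"
proof -
  obtain g where g: "g \<noteq> 0" "\<And>w c. g w \<noteq> 0 \<Longrightarrow> count_list w c = lam c"
    "\<And>a b. a < b \<Longrightarrow> word_op a b g = 0"
    using word_hw_vector_exists[OF assms] by blast
  have w: "word_weight w = (\<lambda>i. int (lam i))" if "g w \<noteq> 0" for w
    using g(2)[OF that] by (simp add: word_weight_def fun_eq_iff)
  then show ?thesis using that[of g] g word_hw_weight[of g "\<lambda>i. int (lam i)" r] by (simp add: hw_vector_def)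
qed

lemma gl_irrep_correct:
  assumes lam: "is_partition lam" and r: "partition_length lam \<le> r"
  shows "irreducible_gl_rep r (fst (gl_irrep r lam)) (snd (gl_irrep r lam)) \<and>
    has_highest_weight r (fst (gl_irrep r lam)) (snd (gl_irrep r lam)) (\<lambda>i. int (lam i))"
proof -
  let ?L = "\<lambda>i. int (lam i)"
  define n where "n = (\<Sum>c<r. lam c)"
  obtain g where g: "\<And>w. g w \<noteq> 0 \<Longrightarrow> word_weight w = ?L" "hw_vector r word_op ?L g"
    using word_highest_weight_vector[OF lam] by blast
  interpret gl_action r word_op by (rule word_action)
  have "\<And>c. c \<ge> r \<Longrightarrow> ?L c = 0" using partition_nonzero_iff[OF lam] r by (metis le_trans not_less of_nat_0)
  then have ds: "descent_space r word_op ?L g \<omega> \<subseteq> cf.span (indicator_at ` words r n)" for \<omega>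
    using word_descent_space[of g ?L r n \<omega>] g(1)
      cf.span_mono[of "indicator_at ` {w \<in> words r n. word_weight w = \<omega>}" "indicator_at ` words r n"]
    by (fastforce simp: n_def)
  have "cyclic r word_op ?L g \<subseteq> cf.span (indicator_at ` words r n)"
    unfolding cyclic_def
  proof (rule cf.span_minimal)
    show "{x. \<exists>\<omega>. descends r word_op ?L g \<omega> x} \<subseteq> cf.span (indicator_at ` words r n)"
      using ds unfolding descent_space_def by (blast intro: cf.span_base)
  qed simp
  then have "\<exists>d \<rho>. irreducible_gl_rep r d \<rho> \<and> has_highest_weight r d \<rho> ?L"
    using irreducible_quotient[OF g(2)] finite_words by blast
  then have "\<exists>p. case p of (d, \<rho>) \<Rightarrow> irreducible_gl_rep r d \<rho> \<and> has_highest_weight r d \<rho> ?L" by auto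
  then have "case gl_irrep r lam of (d, \<rho>) \<Rightarrow> irreducible_gl_rep r d \<rho> \<and> has_highest_weight r d \<rho> ?L"
    unfolding gl_irrep_def by (rule someI_ex)
  then show ?thesis by (simp add: case_prod_unfold)
qed

text \<open>The condition on the length makes \<open>lam\<close> a weight of \<open>gl_r\<close>. In what follows \<open>dm\<close> and \<open>E\<close> are
  the dimension and the action of the chosen module.\<close>

locale irrep =
  fixes r :: nat and lam :: "nat \<Rightarrow> nat"
  assumes partition: "is_partition lam" and length: "partition_length lam \<le> r"
begin

abbreviation "L \<equiv> \<lambda>i. int (lam i)"
abbreviation "dm \<equiv> fst (gl_irrep r lam)"
abbreviation "E \<equiv> rep_op r dm (snd (gl_irrep r lam))"

sublocale gl_representation r dm "snd (gl_irrep r lam)"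
  by unfold_locales (use gl_irrep_correct[OF partition length] in \<open>auto simp: irreducible_gl_rep_def\<close>)

lemma L_outside: "i \<ge> r \<Longrightarrow> L i = 0"
  using partition_nonzero_iff[OF partition, of i] length by auto

lemma hw_exists: obtains v where "v \<in> supported dm" "hw_vector r E L v"
  using hw_vector_coords gl_irrep_correct[OF partition length] by blast

lemma mult_basis:
  obtains B where "finite B" "cf.independent B" "B \<subseteq> {f \<in> supported dm. weight_vector r E \<omega> f}"
    "{f \<in> supported dm. weight_vector r E \<omega> f} \<subseteq> cf.span B" "card B = gl_mult r lam \<omega>"
  using dim_eq_card_basis[OF weight_space_subspace[of \<omega>]]
  unfolding coords_weight_space gl_mult_def gl_weight_space_def by blast

lemma gl_weights_iff: "\<omega> \<in> gl_weights r lam \<longleftrightarrow> (\<forall>i\<ge>r. \<omega> i = 0) \<and> gl_mult r lam \<omega> \<noteq> 0"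
proof -
  obtain B where B: "finite B" "cf.independent B" "B \<subseteq> {f \<in> supported dm. weight_vector r E \<omega> f}"
    "{f \<in> supported dm. weight_vector r E \<omega> f} \<subseteq> cf.span B" "card B = gl_mult r lam \<omega>"
    using mult_basis by blast
  let ?W = "gl_weight_space r lam \<omega>"
  have W: "?W \<subseteq> carrier_vec dm" "0\<^sub>v dm \<in> ?W"
    using weight_space_subspace[of \<omega>] by (auto simp: vec_subspace_iff gl_weight_space_def)
  have c: "coords ` ?W = {f \<in> supported dm. weight_vector r E \<omega> f}"
    by (simp add: coords_weight_space gl_weight_space_def)
  have "?W = {0\<^sub>v dm} \<longleftrightarrow> B = {}"
  proof
    assume "?W = {0\<^sub>v dm}"
    then have "B \<subseteq> {0}" using B(3) c by auto
    moreover have "0 \<notin> B" using B(2) cf.dependent_zero by blast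
    ultimately show "B = {}" by auto
  next
    assume "B = {}"
    then have "coords ` ?W \<subseteq> {0}" using B(4) c by simp
    have "w = 0\<^sub>v dm" if "w \<in> ?W" for w
      using that \<open>coords ` ?W \<subseteq> {0}\<close> W coords_eq_iff[of w dm "0\<^sub>v dm"] by auto
    then show "?W = {0\<^sub>v dm}" using W(2) by blast
  qed
  moreover have "gl_mult r lam \<omega> \<noteq> 0 \<longleftrightarrow> B \<noteq> {}"
    unfolding B(5)[symmetric] using B(1) by simp
  ultimately show ?thesis by (simp add: gl_weights_def)
qed

lemma mult_le:
  assumes E': "gl_action r E'" "hw_vector r E' L v'"
    and \<omega>: "\<And>i. i \<ge> r \<Longrightarrow> \<omega> i = 0"
    and T: "finite T" "descent_space r E' L v' \<omega> \<subseteq> cf.span T"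
  shows "gl_mult r lam \<omega> \<le> card T"
proof -
  obtain v where v: "v \<in> supported dm" "hw_vector r E L v" by (rule hw_exists)
  obtain B where B: "cf.independent B" "B \<subseteq> {f \<in> supported dm. weight_vector r E \<omega> f}"
    "card B = gl_mult r lam \<omega>"
    using mult_basis by blast
  have "finite B \<and> card B \<le> card T"
  proof (rule multiplicity_le_descent[OF gl_action_axioms E'(1) v(2) E'(2) supported_invariant v(1) _ _ B(1,2) T])
    show "W = {0} \<or> W = supported dm" if "invariant r E W" "W \<subseteq> supported dm" for W
      using irreducible_invariant that gl_irrep_correct[OF partition length] by blast
    show "\<omega> i = L i" if "i \<ge> r" for i using \<omega> L_outside that by simp
  qed
  then show ?thesis using B(3) by simp
qed

text \<open>The comparison of the module with itself: a weight that no lowering product reaches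
  has multiplicity zero.\<close>

lemma weight_descends:
  assumes "\<omega> \<in> gl_weights r lam"
  obtains v x where "descends r E L v \<omega> x"
proof -
  obtain v where v: "v \<in> supported dm" "hw_vector r E L v" by (rule hw_exists)
  have "\<exists>x. descends r E L v \<omega> x"
  proof (rule ccontr)
    assume "\<nexists>x. descends r E L v \<omega> x"
    then have "descent_space r E L v \<omega> \<subseteq> cf.span {}" by (simp add: descent_space_def)
    then have "gl_mult r lam \<omega> \<le> card {}"
      using mult_le[OF gl_action_axioms v(2), of \<omega> "{}"] assms by (auto simp: gl_weights_iff)
    then show False using assms by (simp add: gl_weights_iff)
  qed
  then show ?thesis using that by blast
qed

lemma weight_dominated: "\<omega> \<in> gl_weights r lam \<Longrightarrow> (\<Sum>j\<le>i. \<omega> j) \<le> (\<Sum>j\<le>i. L j)"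
  by (metis weight_descends descends_dominated)

lemma weight_total: "\<omega> \<in> gl_weights r lam \<Longrightarrow> (\<Sum>j<r. \<omega> j) = (\<Sum>j<r. L j)"
  by (metis weight_descends descends_total)

lemma mult_le_words:
  assumes "\<And>i. i \<ge> r \<Longrightarrow> \<omega> i = 0"
  shows "gl_mult r lam \<omega> \<le> card {w \<in> words r (\<Sum>c<r. lam c). word_weight w = \<omega>}"
proof -
  obtain g where g: "\<And>w. g w \<noteq> 0 \<Longrightarrow> word_weight w = L" "hw_vector r word_op L g"
    using word_highest_weight_vector[OF partition] by blast
  let ?W = "{w \<in> words r (\<Sum>c<r. lam c). word_weight w = \<omega>}"
  have fin: "finite ?W" using finite_words by simp
  have "gl_mult r lam \<omega> \<le> card (indicator_at ` ?W)"
    by (rule mult_le[OF word_action g(2) assms])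
      (use fin word_descent_space[of g L r "\<Sum>c<r. lam c" \<omega>] g(1) L_outside in auto)
  also have "\<dots> \<le> card ?W" using fin by (rule card_image_le)
  finally show ?thesis .
qed

lemma finite_weights: "finite (gl_weights r lam)"
proof (rule finite_subset)
  show "gl_weights r lam \<subseteq> word_weight ` words r (\<Sum>c<r. lam c)"
  proof
    fix \<omega> assume "\<omega> \<in> gl_weights r lam"
    then have "card {w \<in> words r (\<Sum>c<r. lam c). word_weight w = \<omega>} \<noteq> 0"
      using mult_le_words[of \<omega>] by (auto simp: gl_weights_iff)
    then show "\<omega> \<in> word_weight ` words r (\<Sum>c<r. lam c)" by (auto simp: card_eq_0_iff)
  qed
qed (simp add: finite_words)

text \<open>In the module of the larger algebra, \<open>gl_r\<close> commutes with the last diagonal matrix unit, which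
  annihilates \<open>v\<close>. So the vectors reached from \<open>v\<close> by \<open>gl_r\<close> have last weight coordinate \<open>0\<close>.\<close>

lemma mult_le_Suc:
  assumes \<omega>: "\<And>i. i \<ge> r \<Longrightarrow> \<omega> i = 0"
  shows "gl_mult r lam \<omega> \<le> gl_mult (Suc r) lam \<omega>"
proof -
  interpret S: irrep "Suc r" lam by unfold_locales (use partition length in auto)
  obtain v where v: "v \<in> supported S.dm" "hw_vector (Suc r) S.E L v" by (rule S.hw_exists)
  obtain B where "finite B" "cf.independent B" "B \<subseteq> {f \<in> supported S.dm. weight_vector (Suc r) S.E \<omega> f}"
    "{f \<in> supported S.dm. weight_vector (Suc r) S.E \<omega> f} \<subseteq> cf.span B" "card B = gl_mult (Suc r) lam \<omega>"
    by (rule S.mult_basis)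
  note B = this(1,4,5)
  have R: "gl_action r S.E" by (rule gl_action_restrict[OF S.gl_action_axioms]) simp
  have vr: "hw_vector r S.E L v" by (rule hw_vector_restrict[OF v(2)]) simp
  have desc: "x \<in> supported S.dm \<and> S.E r r x = 0" if "descends r S.E L v \<mu> x" for \<mu> x
    using that
  proof (induction rule: descends.induct)
    case top
    have "S.E r r v = cscale (of_int (L r)) v" using v(2) by (simp add: hw_vector_def weight_vector_def)
    then show ?case using v(1) L_outside[of r] by simp
  next
    case (lower \<mu> x b a)
    have ab: "a < Suc r" "b < Suc r" "r \<noteq> a" "r \<noteq> b" using lower.hyps by simp_all
    have "S.E r r (S.E a b x) = S.E a b (S.E r r x)"
      unfolding S.bracket[OF lessI lessI ab(1,2), of x] using ab(3,4) by simp
    also have "S.E r r x = 0" using lower.IH by simp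
    also have "S.E a b 0 = 0" using ab(1,2) by (rule S.zero)
    finally show ?case by (simp add: rep_op_def)
  qed
  have "descends r S.E L v \<omega> x \<Longrightarrow> x \<in> {f \<in> supported S.dm. weight_vector (Suc r) S.E \<omega> f}" for x
    using desc[of \<omega> x] gl_action.descends_weight[OF R, of L v \<omega> x] vr \<omega>[of r]
    by (auto simp: weight_vector_def hw_vector_def less_Suc_eq)
  then have "descent_space r S.E L v \<omega> \<subseteq> cf.span B"
    unfolding descent_space_def using B(2) by (intro cf.span_minimal) auto
  then show ?thesis using mult_le[OF R vr \<omega> B(1)] B(3) by simp
qed

end

section \<open>Convergence\<close>

lemma words_Suc: "words r (Suc n) = (\<lambda>(a, w). a # w) ` ({..<r} \<times> words r n)"
  unfolding words_def by (auto simp: length_Suc_conv image_iff)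

lemma sum_words_prod_list:
  fixes g :: "nat \<Rightarrow> real"
  shows "(\<Sum>w\<in>words r n. prod_list (map g w)) = (\<Sum>a<r. g a) ^ n"
proof (induction n)
  case 0
  have "words r 0 = {[]}" by (auto simp: words_def)
  then show ?case by simp
next
  case (Suc n)
  have "inj_on (\<lambda>(a, w). a # w) ({..<r} \<times> words r n)" by (auto simp: inj_on_def)
  then have "(\<Sum>w\<in>words r (Suc n). prod_list (map g w)) =
      (\<Sum>(a, w)\<in>{..<r} \<times> words r n. g a * prod_list (map g w))"
    unfolding words_Suc by (simp add: sum.reindex case_prod_unfold)
  also have "\<dots> = (\<Sum>a<r. \<Sum>w\<in>words r n. g a * prod_list (map g w))"
    by (simp add: sum.cartesian_product)
  also have "\<dots> = (\<Sum>a<r. g a) * (\<Sum>w\<in>words r n. prod_list (map g w))"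
    by (rule sum_product[symmetric])
  finally show ?case using Suc by simp
qed

lemma sum_power_diff_le:
  fixes q :: real
  assumes "0 \<le> q" "q < 1"
  shows "(\<Sum>a<r. q ^ (a - l)) \<le> real l + 1 / (1 - q)"
proof -
  have "(\<Sum>a<r. q ^ (a - l)) \<le> (\<Sum>a<l + r. q ^ (a - l))"
    using assms by (intro sum_mono2) auto
  also have "\<dots> = (\<Sum>a<l. q ^ (a - l)) + (\<Sum>a=l..<l + r. q ^ (a - l))"
    using sum.atLeastLessThan_concat[of 0 l "l + r" "\<lambda>a. q ^ (a - l)"] by (simp add: atLeast0LessThan)
  also have "(\<Sum>a<l. q ^ (a - l)) = real l" by simp
  also have "(\<Sum>a=l..<l + r. q ^ (a - l)) = (\<Sum>a<r. q ^ a)"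
    unfolding sum.atLeastLessThan_shift_0[of _ l] by (simp add: atLeast0LessThan)
  also have "\<dots> = (1 - q ^ r) / (1 - q)" using assms by (simp add: sum_gp_strict)
  also have "\<dots> \<le> 1 / (1 - q)" using assms by (intro divide_right_mono) auto
  finally show ?thesis by simp
qed

lemma sum_word_weight_atMost:
  "(\<Sum>j\<le>i. word_weight w j) = int (length (filter (\<lambda>a. a \<le> i) w))"
proof -
  have "(\<Sum>j\<le>i. count_list w j) = length (filter (\<lambda>a. a \<le> i) w)"
  proof (induction w)
    case (Cons a w)
    have "(\<Sum>j\<le>i. count_list (a # w) j) = (\<Sum>j\<le>i. (if j = a then 1 else 0) + count_list w j)"
      by (intro sum.cong) auto
    then show ?case using Cons by (simp add: sum.distrib)
  qed simp
  then show ?thesis by (simp add: word_weight_def flip: of_nat_sum)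
qed

text \<open>Double counting of the pairs of a letter \<open>a\<close> and an index \<open>i\<close> with \<open>l \<le> i < a\<close>.\<close>

lemma sum_letters_above:
  assumes "set w \<subseteq> {..<r}"
  shows "(\<Sum>i=l..<r - 1. length (filter (\<lambda>a. i < a) w)) = sum_list (map (\<lambda>a. a - l) w)"
  using assms
proof (induction w)
  case (Cons a w)
  have "{l..<r - 1} \<inter> {i. i < a} = {l..<a}" using Cons.prems by auto
  then have "(\<Sum>i=l..<r - 1. if i < a then 1 else 0) = a - l"
    by (simp add: sum.If_cases)
  moreover have "(\<Sum>i=l..<r - 1. length (filter (\<lambda>a. i < a) (a # w))) =
      (\<Sum>i=l..<r - 1. if i < a then 1 else 0) + (\<Sum>i=l..<r - 1. length (filter (\<lambda>a. i < a) w))"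
    unfolding sum.distrib[symmetric] by (intro sum.cong) auto
  ultimately show ?case using Cons by simp
qed simp

lemma prod_list_power: "prod_list (map (\<lambda>a. q ^ f a) w) = (q :: real) ^ sum_list (map f w)"
  by (induction w) (simp_all add: power_add)

text \<open>The exponent of \<open>\<theta> i\<close> in the monomial of \<open>\<omega>\<close>, free of \<open>r\<close>.\<close>

definition exponent :: "(nat \<Rightarrow> nat) \<Rightarrow> (nat \<Rightarrow> int) \<Rightarrow> nat \<Rightarrow> int" where
  "exponent lam \<omega> i = (\<Sum>j\<le>i. int (lam j) - \<omega> j)"

lemma weight_inner_fund_coweight:
  assumes "i < r"
  shows "weight_inner r (\<lambda>j. int (lam j) - \<omega> j) (fund_coweight i) = exponent lam \<omega> i"
proof -
  have "weight_inner r (\<lambda>j. int (lam j) - \<omega> j) (fund_coweight i) =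
      (\<Sum>j<r. if j \<le> i then int (lam j) - \<omega> j else 0)"
    unfolding weight_inner_def fund_coweight_def by (intro sum.cong) auto
  also have "\<dots> = (\<Sum>j\<in>{..<r} \<inter> {..i}. int (lam j) - \<omega> j)"
    by (simp add: sum.inter_restrict)
  also have "{..<r} \<inter> {..i} = {..i}" using assms by auto
  finally show ?thesis by (simp add: exponent_def)
qed

lemma S_gl_exponent:
  "S_gl r lam \<theta> = (\<Sum>\<omega>\<in>gl_weights r lam. real (gl_mult r lam \<omega>) * (\<Prod>i<r - 1. \<theta> i powi exponent lam \<omega> i))"
  unfolding S_gl_def by (intro sum.cong prod.cong refl arg_cong2[of _ _ _ _ "(*)"]) (simp add: weight_inner_fund_coweight)

context irrep
begin

lemma exponent_nonneg: "\<omega> \<in> gl_weights r lam \<Longrightarrow> exponent lam \<omega> i \<ge> 0"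
  using weight_dominated[of \<omega> i] by (simp add: exponent_def sum_subtractf)

lemma S_gl_le_Suc:
  assumes \<theta>: "\<And>i. \<theta> i > 0" and r: "r > 0"
  shows "S_gl r lam \<theta> \<le> S_gl (Suc r) lam \<theta>"
proof -
  interpret S: irrep "Suc r" lam by unfold_locales (use partition length in auto)
  have sub: "gl_weights r lam \<subseteq> gl_weights (Suc r) lam"
  proof
    fix \<omega> assume \<omega>: "\<omega> \<in> gl_weights r lam"
    then have "gl_mult r lam \<omega> \<le> gl_mult (Suc r) lam \<omega>" by (intro mult_le_Suc) (simp add: gl_weights_iff)
    then show "\<omega> \<in> gl_weights (Suc r) lam" using \<omega> by (simp add: gl_weights_iff S.gl_weights_iff)
  qed
  have pos: "(\<Prod>i<k. \<theta> i powi exponent lam \<omega> i) \<ge> 0" for k \<omega>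
    using \<theta> by (intro prod_nonneg) (simp add: less_imp_le)
  have "S_gl r lam \<theta> \<le> (\<Sum>\<omega>\<in>gl_weights r lam. real (gl_mult (Suc r) lam \<omega>) * (\<Prod>i<Suc r - 1. \<theta> i powi exponent lam \<omega> i))"
    unfolding S_gl_exponent
  proof (rule sum_mono)
    fix \<omega> assume \<omega>: "\<omega> \<in> gl_weights r lam"
    have "exponent lam \<omega> (r - 1) = (\<Sum>j<r. int (lam j) - \<omega> j)"
      using r by (simp add: exponent_def flip: lessThan_Suc_atMost)
    also have "\<dots> = 0" using weight_total[OF \<omega>] by (simp add: sum_subtractf)
    finally have "(\<Prod>i<Suc r - 1. \<theta> i powi exponent lam \<omega> i) = (\<Prod>i<r - 1. \<theta> i powi exponent lam \<omega> i)"
      using r by (cases r) simp_all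
    moreover have "gl_mult r lam \<omega> \<le> gl_mult (Suc r) lam \<omega>"
      using \<omega> by (intro mult_le_Suc) (simp add: gl_weights_iff)
    ultimately show "real (gl_mult r lam \<omega>) * (\<Prod>i<r - 1. \<theta> i powi exponent lam \<omega> i) \<le>
      real (gl_mult (Suc r) lam \<omega>) * (\<Prod>i<Suc r - 1. \<theta> i powi exponent lam \<omega> i)"
      using pos by (simp only:) (intro mult_right_mono, simp_all)
  qed
  also have "\<dots> \<le> S_gl (Suc r) lam \<theta>"
    unfolding S_gl_exponent
    using sub S.finite_weights pos by (intro sum_mono2) auto
  finally show ?thesis .
qed

text \<open>For \<open>i\<close> beyond the length of \<open>lam\<close>, the partial sum of \<open>lam\<close> up to \<open>i\<close> is the
  length of the word.\<close>

lemma exponent_letters_above: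
  assumes "w \<in> words r (\<Sum>c<r. lam c)" "partition_length lam \<le> i" "i < r"
  shows "exponent lam (word_weight w) i = int (length (filter (\<lambda>a. i < a) w))"
proof -
  have "(\<Sum>j\<le>i. lam j) = (\<Sum>c<r. lam c)"
    using assms(2,3) partition_nonzero_iff[OF partition] by (intro sum.mono_neutral_left) force+
  then have "(\<Sum>j\<le>i. int (lam j)) = int (length w)"
    using assms(1) by (simp add: words_def flip: of_nat_sum)
  moreover have "length w = length (filter (\<lambda>a. a \<le> i) w) + length (filter (\<lambda>a. i < a) w)"
    using sum_length_filter_compl[of "\<lambda>a. a \<le> i" w] by (simp add: not_le)
  ultimately show ?thesis by (simp add: exponent_def sum_subtractf sum_word_weight_atMost)
qed

text \<open>Indices below the length of \<open>lam\<close> contribute factors at most \<open>1\<close>, by dominance. The others are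
  bounded by powers of \<open>q\<close> and regrouped by letters.\<close>

lemma weight_monomial_le:
  fixes \<theta> :: "nat \<Rightarrow> real" and q :: real
  assumes \<theta>: "\<And>i. \<theta> i > 0" "\<And>i. \<theta> i \<le> q" and q: "q < 1"
    and w: "w \<in> words r (\<Sum>c<r. lam c)" "word_weight w \<in> gl_weights r lam"
  shows "(\<Prod>i<r - 1. \<theta> i powi exponent lam (word_weight w) i) \<le>
    prod_list (map (\<lambda>a. q ^ (a - partition_length lam)) w)"
proof -
  let ?l = "partition_length lam" and ?above = "\<lambda>i. length (filter (\<lambda>a. i < a) w)"
  have q0: "q > 0" using \<theta>(1)[of 0] \<theta>(2)[of 0] by linarith
  have "(\<Prod>i<r - 1. \<theta> i powi exponent lam (word_weight w) i) \<le>
      (\<Prod>i<r - 1. if ?l \<le> i then q ^ ?above i else 1)"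
  proof (intro prod_mono conjI)
    fix i assume i: "i \<in> {..<r - 1}"
    obtain m where m: "exponent lam (word_weight w) i = int m"
      by (rule nonneg_int_cases[OF exponent_nonneg[OF w(2)]])
    show "0 \<le> \<theta> i powi exponent lam (word_weight w) i" using \<theta>(1) by (simp add: less_imp_le)
    show "\<theta> i powi exponent lam (word_weight w) i \<le> (if ?l \<le> i then q ^ ?above i else 1)"
    proof (cases "?l \<le> i")
      case True
      then have "m = ?above i" using exponent_letters_above[OF w(1) True] m i by simp
      then show ?thesis using True m \<theta> by (simp add: power_mono less_imp_le)
    next
      case False
      have "\<theta> i \<le> 1" using \<theta>(2)[of i] q by simp
      then show ?thesis using False m \<theta>(1) by (simp add: power_le_one less_imp_le)
    qed
  qed
  also have "\<dots> = (\<Prod>i\<in>{..<r - 1} \<inter> {?l..}. q ^ ?above i)"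
    by (simp add: prod.inter_restrict)
  also have "{..<r - 1} \<inter> {?l..} = {?l..<r - 1}" by auto
  also have "(\<Prod>i=?l..<r - 1. q ^ ?above i) = q ^ (\<Sum>i=?l..<r - 1. ?above i)"
    by (simp add: power_sum)
  also have "\<dots> = prod_list (map (\<lambda>a. q ^ (a - ?l)) w)"
    using w(1) sum_letters_above[of w r ?l] by (simp add: words_def prod_list_power)
  finally show ?thesis .
qed

lemma S_gl_le:
  assumes \<theta>: "\<And>i. \<theta> i > 0" "\<And>i. \<theta> i \<le> q" and q: "q < 1"
  shows "S_gl r lam \<theta> \<le> (real (partition_length lam) + 1 / (1 - q)) ^ (\<Sum>c<r. lam c)"
proof -
  let ?l = "partition_length lam" and ?n = "\<Sum>c<r. lam c"
  let ?W = "words r ?n" and ?p = "\<lambda>\<omega>. \<Prod>i<r - 1. \<theta> i powi exponent lam \<omega> i"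
  let ?g = "\<lambda>w. prod_list (map (\<lambda>a. q ^ (a - ?l)) w)"
  have q0: "q > 0" using \<theta>(1)[of 0] \<theta>(2)[of 0] by linarith
  have g0: "?g w \<ge> 0" for w using q0 by (intro prod_list_nonneg) auto
  have "S_gl r lam \<theta> \<le> (\<Sum>\<omega>\<in>gl_weights r lam. \<Sum>w\<in>{w \<in> ?W. word_weight w = \<omega>}. ?g w)"
    unfolding S_gl_exponent
  proof (rule sum_mono)
    fix \<omega> assume \<omega>: "\<omega> \<in> gl_weights r lam"
    have "real (gl_mult r lam \<omega>) * ?p \<omega> \<le> real (card {w \<in> ?W. word_weight w = \<omega>}) * ?p \<omega>"
      using \<omega> mult_le_words[of \<omega>] \<theta>(1)
      by (intro mult_right_mono prod_nonneg) (auto simp: gl_weights_iff less_imp_le)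
    also have "\<dots> = (\<Sum>w\<in>{w \<in> ?W. word_weight w = \<omega>}. ?p (word_weight w))" by simp
    also have "\<dots> \<le> (\<Sum>w\<in>{w \<in> ?W. word_weight w = \<omega>}. ?g w)"
      using weight_monomial_le[OF \<theta> q] \<omega> by (intro sum_mono) auto
    finally show "real (gl_mult r lam \<omega>) * ?p \<omega> \<le> (\<Sum>w\<in>{w \<in> ?W. word_weight w = \<omega>}. ?g w)" .
  qed
  also have "\<dots> = (\<Sum>w\<in>(\<Union>\<omega>\<in>gl_weights r lam. {w \<in> ?W. word_weight w = \<omega>}). ?g w)"
    using finite_weights finite_words by (subst sum.UNION_disjoint) auto
  also have "\<dots> \<le> (\<Sum>w\<in>?W. ?g w)"
    using finite_words g0 by (intro sum_mono2) auto
  also have "\<dots> = (\<Sum>a<r. q ^ (a - ?l)) ^ ?n" by (rule sum_words_prod_list)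
  also have "\<dots> \<le> (real ?l + 1 / (1 - q)) ^ ?n"
    using q0 q by (intro power_mono sum_power_diff_le sum_nonneg) auto
  finally show ?thesis .
qed

end

theorem theorem4p2p3:
  fixes lam :: "nat \<Rightarrow> nat" and \<theta> :: "nat \<Rightarrow> real"
  assumes "is_partition lam"
    and "\<And>i. \<theta> i > 0"
    and "Bseq \<theta>"
    and "(SUP i. \<theta> i) < 1"
  shows "convergent (\<lambda>k. S_gl (max 1 (partition_length lam) + k) lam \<theta>)"
proof -
  let ?l = "partition_length lam" and ?q = "SUP i. \<theta> i"
  let ?X = "\<lambda>k. S_gl (max 1 ?l + k) lam \<theta>"
  let ?C = "(real ?l + 1 / (1 - ?q)) ^ (\<Sum>c<?l. lam c)"
  have "bdd_above (range \<theta>)"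
    using assms(3) by (rule Bseq_bdd_above)
  then have le: "\<theta> i \<le> ?q" for i by (rule cSUP_upper[OF UNIV_I])
  have irr: "irrep (max 1 ?l + k) lam" for k
    by unfold_locales (use assms(1) in auto)
  have "?X k \<le> ?X (Suc k)" for k
    unfolding add_Suc_right by (rule irrep.S_gl_le_Suc[OF irr assms(2)]) (simp add: less_max_iff_disj)
  then have inc: "incseq ?X" by (rule incseq_SucI)
  have bound: "?X k \<le> ?C" for k
  proof -
    have "lam c = 0" if "c \<notin> {..<?l}" for c
      using partition_nonzero_iff[OF assms(1), of c] that by simp
    then have size: "(\<Sum>c<max 1 ?l + k. lam c) = (\<Sum>c<?l. lam c)"
      by (intro sum.mono_neutral_right) (simp_all add: subset_iff)
    show ?thesis using irrep.S_gl_le[OF irr[of k] assms(2) le assms(4)] unfolding size .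
  qed
  show ?thesis
  proof (rule incseq_convergent[OF inc])
    show "\<forall>k. ?X k \<le> ?C" by (intro allI bound)
    fix x assume "?X \<longlonglongrightarrow> x"
    then show ?thesis by (rule convergentI)
  qed
qed

end
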